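(* For each integer $k\ge 3$ let $J_k$ denote either the path $P_k$ or the cycle $C_k$, and for $k=1,2$ let $J_k=P_k$. For all integers $n,m\ge 1$, and for every choice of the factors $J_n$ and $J_m$ (made independently of each other), $\operatorname{th}_{\rm pd}^{\times}(J_n\Box J_m)=\gamma(J_n\Box J_m)$.
   Context: All graphs are finite, simple and undirected. $P_k$ and $C_k$ are the path and cycle on $k$ vertices. The Cartesian product $G\Box H$ has vertex set $V(G)\times V(H)$, with $(x_1,y_1)$ and $(x_2,y_2)$ adjacent if either $x_1=x_2$ and $y_1y_2\in E(H)$, or $y_1=y_2$ and $x_1x_2\in E(G)$. Let $G$ be a graph. $\gamma(G)$ is the domination number: the minimum $|S|$ over $S\subseteq V(G)$ with $N[S]=V(G)$, where $N[S]$ is the closed neighborhood of $S$. For nonempty $S\subseteq V(G)$ define $P^{[0]}(S)=S$, $P^{[1]}(S)=N[S]$, and for $i\ge 1$, $P^{[i+1]}(S)=P^{[i]}(S)\cup\{w\in V(G)\setminus P^{[i]}(S): \exists u\in P^{[i]}(S),\ N(u)\setminus P^{[i]}(S)=\{w\}\}$. $S$ is a power dominating set if $P^{[t]}(S)=V(G)$ for some $t$. The power propagation time $\operatorname{pt}_{\rm pd}(G;S)$ is the least positive integer $t$ with $P^{[t]}(S)=V(G)$ (so it is at least $1$, even for $S=V(G)$), and is $\infty$ if $S$ is not a power dominating set. The product power throttling number is $\operatorname{th}_{\rm pd}^{\times}(G)=\min_{\emptyset\ne S\subseteq V(G)}|S|\operatorname{pt}_{\rm pd}(G;S)$. *)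

theory Defs
  imports "Graph_Theory.Pair_Digraph" "HOL-Library.Extended_Nat"
begin

text \<open>
  A finite simple undirected graph is a \<^term>\<open>pair_graph\<close>: a finite, loop-free, symmetric set of
  arcs, so that the edge \<open>uv\<close> is the pair of arcs \<open>(u,v)\<close>, \<open>(v,u)\<close>.
\<close>

definition path_graph :: "nat \<Rightarrow> nat pair_pre_digraph" where
  "path_graph n = \<lparr> pverts = {..<n},
     parcs = {(i, j). i < n \<and> j < n \<and> (j = Suc i \<or> i = Suc j)} \<rparr>"

text \<open>Only meaningful for \<open>n \<ge> 3\<close> (for \<open>n = 1\<close> the formula gives a loop).\<close>

definition cycle_graph :: "nat \<Rightarrow> nat pair_pre_digraph" where
  "cycle_graph n = \<lparr> pverts = {..<n},
     parcs = {(i, j). i < n \<and> j < n \<and> (j = Suc i mod n \<or> i = Suc j mod n)} \<rparr>"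

text \<open>The graphs allowed as a factor on \<open>n\<close> vertices.\<close>

definition path_or_cycle :: "nat \<Rightarrow> nat pair_pre_digraph set" where
  "path_or_cycle n = (if n \<ge> 3 then {path_graph n, cycle_graph n} else {path_graph n})"

definition cartesian_product ::
    "'a pair_pre_digraph \<Rightarrow> 'b pair_pre_digraph \<Rightarrow> ('a \<times> 'b) pair_pre_digraph" where
  "cartesian_product G H = \<lparr> pverts = pverts G \<times> pverts H,
     parcs = {((x1, y1), (x2, y2)).
       (x1, y1) \<in> pverts G \<times> pverts H \<and> (x2, y2) \<in> pverts G \<times> pverts H \<and>
       (x1 = x2 \<and> (y1, y2) \<in> parcs H \<or> y1 = y2 \<and> (x1, x2) \<in> parcs G)} \<rparr>"

definition nbhd :: "'a pair_pre_digraph \<Rightarrow> 'a \<Rightarrow> 'a set" where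
  "nbhd G u = {w. (u, w) \<in> parcs G}"

definition closed_nbhd :: "'a pair_pre_digraph \<Rightarrow> 'a set \<Rightarrow> 'a set" where
  "closed_nbhd G S = S \<union> (\<Union>u\<in>S. nbhd G u)"

definition dominating_set :: "'a pair_pre_digraph \<Rightarrow> 'a set \<Rightarrow> bool" where
  "dominating_set G S \<longleftrightarrow> S \<subseteq> pverts G \<and> closed_nbhd G S = pverts G"

definition domination_number :: "'a pair_pre_digraph \<Rightarrow> nat" where
  "domination_number G = Min (card ` {S. dominating_set G S})"

fun power_prop :: "'a pair_pre_digraph \<Rightarrow> 'a set \<Rightarrow> nat \<Rightarrow> 'a set" where
  "power_prop G S 0 = S"
| "power_prop G S (Suc 0) = closed_nbhd G S"
| "power_prop G S (Suc (Suc i)) = power_prop G S (Suc i) \<union>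
     {w \<in> pverts G - power_prop G S (Suc i).
        \<exists>u \<in> power_prop G S (Suc i). nbhd G u - power_prop G S (Suc i) = {w}}"

definition power_dominating_set :: "'a pair_pre_digraph \<Rightarrow> 'a set \<Rightarrow> bool" where
  "power_dominating_set G S \<longleftrightarrow> S \<subseteq> pverts G \<and> S \<noteq> {} \<and> (\<exists>t. power_prop G S t = pverts G)"

definition power_prop_time :: "'a pair_pre_digraph \<Rightarrow> 'a set \<Rightarrow> enat" where
  "power_prop_time G S =
     (if power_dominating_set G S
      then enat (LEAST t. t \<ge> 1 \<and> power_prop G S t = pverts G) else \<infinity>)"

definition product_power_throttling :: "'a pair_pre_digraph \<Rightarrow> enat" where
  "product_power_throttling G =
     Min ((\<lambda>S. enat (card S) * power_prop_time G S) ` {S. S \<noteq> {} \<and> S \<subseteq> pverts G})"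

lemma pair_graph_path: "pair_graph (path_graph n)"
proof
  have "parcs (path_graph n) \<subseteq> {..<n} \<times> {..<n}"
    by (auto simp: path_graph_def)
  then show "finite (parcs (path_graph n))"
    by (rule finite_subset) simp
qed (auto simp: path_graph_def symmetric_def arcs_ends_def arc_to_ends_def intro!: symI)

lemma pair_graph_cycle:
  assumes "n \<ge> 3"
  shows "pair_graph (cycle_graph n)"
proof
  have "parcs (cycle_graph n) \<subseteq> {..<n} \<times> {..<n}"
    by (auto simp: cycle_graph_def)
  then show "finite (parcs (cycle_graph n))"
    by (rule finite_subset) simp
  have "i \<noteq> Suc i mod n" if "i < n" for i
    using assms that by (cases "Suc i = n") auto
  then show "fst e \<noteq> snd e" if "e \<in> parcs (cycle_graph n)" for e
    using that by (fastforce simp: cycle_graph_def)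
qed (auto simp: cycle_graph_def symmetric_def arcs_ends_def arc_to_ends_def intro!: symI)

lemma pair_graph_cartesian_product:
  assumes "pair_graph G" "pair_graph H"
  shows "pair_graph (cartesian_product G H)"
proof -
  interpret G: pair_graph G by fact
  interpret H: pair_graph H by fact
  have sG: "(b, a) \<in> parcs G" if "(a, b) \<in> parcs G" for a b
    using that G.pair_sym_arcs by (auto simp: symmetric_def dest: symD)
  have sH: "(b, a) \<in> parcs H" if "(a, b) \<in> parcs H" for a b
    using that H.pair_sym_arcs by (auto simp: symmetric_def dest: symD)
  show ?thesis
  proof
    show "finite (pverts (cartesian_product G H))"
      by (simp add: cartesian_product_def)
    have "parcs (cartesian_product G H) \<subseteq> (pverts G \<times> pverts H) \<times> (pverts G \<times> pverts H)"
      by (auto simp: cartesian_product_def)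
    then show "finite (parcs (cartesian_product G H))"
      by (rule finite_subset) simp
    show "fst e \<noteq> snd e" if "e \<in> parcs (cartesian_product G H)" for e
      using that G.pair_no_loops H.pair_no_loops by (fastforce simp: cartesian_product_def)
    show "symmetric (with_proj (cartesian_product G H))"
      by (auto simp: cartesian_product_def symmetric_def arcs_ends_def arc_to_ends_def
          intro!: symI dest: sG sH)
  qed (auto simp: cartesian_product_def)
qed

lemma pair_graph_path_or_cycle: "J \<in> path_or_cycle n \<Longrightarrow> pair_graph J"
  by (auto simp: path_or_cycle_def pair_graph_path pair_graph_cycle split: if_splits)

end

(* Since t = 1 is ordinary domination, it suffices to show |S| t >= gamma when S propagates in
   t >= 2 steps.  Every vertex forces at most once, so each step after the second observes at
   most 4|S| new vertices, and the heart of the matter is that the first two steps observe at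
   most 8|S|.  To see this, share out the weight 1 of a vertex of N[S] - S, and the extra weight
   1 if it forces in step 2, among its neighbours in S: a vertex of S whose share exceeds 7
   would need four forcing neighbours of its own, which the four-cycles around it exclude.
   Hence nm <= 4|S|t.  If equality holds, every share is 7, and the local structure makes S
   run in a zigzag (0,0), (2,1), (4,0), (6,1), ... along one of the factors, which must then be
   a cycle of length divisible by 4.  In that case gamma <= nm/4 by an explicit pattern, and
   otherwise nm < 4|S|t is enough because gamma <= floor(nm/4) + 1 for n, m >= 2.  Products
   with a single vertex have maximum degree 2 and are handled by the same count. *)

theory Submission
  imports Defs
begin

section \<open>Dominating sets of grids\<close>

text \<open>A bound with a witness instead of a minimum: it is monotone in \<open>k\<close> and
  passes through edge additions, factor swaps and gluing without any minimality argument.\<close>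

definition dominable :: "'a pair_pre_digraph \<Rightarrow> nat \<Rightarrow> bool" where
  "dominable G k \<longleftrightarrow>
     (\<exists>D \<subseteq> pverts G. card D \<le> k \<and> (\<forall>v\<in>pverts G. v \<in> D \<or> (\<exists>u\<in>D. (u, v) \<in> parcs G)))"

abbreviation grid :: "nat \<Rightarrow> nat \<Rightarrow> (nat \<times> nat) pair_pre_digraph" where
  "grid n m \<equiv> cartesian_product (path_graph n) (path_graph m)"

section \<open>Transfer of dominating sets between graphs\<close>

lemma dominable_le: "dominable G k \<Longrightarrow> k \<le> l \<Longrightarrow> dominable G l"
  unfolding dominable_def by (meson le_trans)

lemma domination_number_le:
  assumes "finite (pverts G)" "parcs G \<subseteq> pverts G \<times> pverts G" "dominable G k"
  shows "domination_number G \<le> k"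
proof -
  obtain D where D: "D \<subseteq> pverts G" "card D \<le> k"
      "\<forall>v\<in>pverts G. v \<in> D \<or> (\<exists>u\<in>D. (u, v) \<in> parcs G)"
    using assms(3) unfolding dominable_def by blast
  have "dominating_set G D"
    using D assms(2) by (auto simp: dominating_set_def closed_nbhd_def nbhd_def)
  moreover have "finite {S. dominating_set G S}"
    using assms(1) by (auto simp: dominating_set_def intro: finite_subset[of _ "Pow (pverts G)"])
  ultimately have "domination_number G \<le> card D"
    unfolding domination_number_def by (intro Min_le) auto
  with D(2) show ?thesis by simp
qed

text \<open>Carries bounds from grids over to products with cycles, which only have additional
  edges.\<close>

lemma dominable_mono:
  assumes "dominable G k" "pverts H = pverts G" "parcs G \<subseteq> parcs H"
  shows "dominable H k"
  using assms unfolding dominable_def by (metis subsetD)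

lemma dominable_swap:
  assumes "dominable (cartesian_product G H) k"
  shows "dominable (cartesian_product H G) k"
proof -
  let ?G = "cartesian_product G H" and ?H = "cartesian_product H G"
  obtain D where D: "D \<subseteq> pverts ?G" "card D \<le> k"
      "\<forall>v\<in>pverts ?G. v \<in> D \<or> (\<exists>u\<in>D. (u, v) \<in> parcs ?G)"
    using assms unfolding dominable_def by blast
  have V: "prod.swap v \<in> pverts ?G \<longleftrightarrow> v \<in> pverts ?H" for v
    by (cases v) (auto simp: cartesian_product_def)
  have E: "(prod.swap u, prod.swap v) \<in> parcs ?H \<longleftrightarrow> (u, v) \<in> parcs ?G" for u v
    by (cases u; cases v) (auto simp: cartesian_product_def)
  show ?thesis
    unfolding dominable_def
  proof (intro exI[of _ "prod.swap ` D"] conjI ballI)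
    show "prod.swap ` D \<subseteq> pverts ?H"
      using D(1) V by (metis (no_types, lifting) image_subsetI subsetD swap_swap)
    show "card (prod.swap ` D) \<le> k"
      using D(2) by (simp add: card_image)
    fix v assume "v \<in> pverts ?H"
    then consider "prod.swap v \<in> D" | u where "u \<in> D" "(u, prod.swap v) \<in> parcs ?G"
      using D(3) V by blast
    then show "v \<in> prod.swap ` D \<or> (\<exists>u\<in>prod.swap ` D. (u, v) \<in> parcs ?H)"
    proof cases
      case 1
      then show ?thesis by (metis imageI swap_swap)
    next
      case 2
      then show ?thesis using E[of u "prod.swap v"] by auto
    qed
  qed
qed

text \<open>Edges between the two blocks of rows are ignored: the union of both dominating sets, the
  second shifted by \<open>a\<close>, works.\<close>

lemma dominable_stack:
  assumes "dominable (grid a m) k" "dominable (grid b m) l"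
  shows "dominable (grid (a + b) m) (k + l)"
proof -
  obtain D where D: "D \<subseteq> pverts (grid a m)" "card D \<le> k"
      "\<forall>v\<in>pverts (grid a m). v \<in> D \<or> (\<exists>u\<in>D. (u, v) \<in> parcs (grid a m))"
    using assms(1) unfolding dominable_def by blast
  obtain E where E: "E \<subseteq> pverts (grid b m)" "card E \<le> l"
      "\<forall>v\<in>pverts (grid b m). v \<in> E \<or> (\<exists>u\<in>E. (u, v) \<in> parcs (grid b m))"
    using assms(2) unfolding dominable_def by blast
  define s where "s = (\<lambda>(i :: nat, j :: nat). (a + i, j))"
  have arc1: "(u, v) \<in> parcs (grid (a + b) m)" if "(u, v) \<in> parcs (grid a m)" for u v
    using that by (auto simp: cartesian_product_def path_graph_def)
  have arc2: "(s u, s v) \<in> parcs (grid (a + b) m)" if "(u, v) \<in> parcs (grid b m)" for u v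
    using that by (auto simp: cartesian_product_def path_graph_def s_def)
  show ?thesis
    unfolding dominable_def
  proof (intro exI[of _ "D \<union> s ` E"] conjI ballI)
    show "D \<union> s ` E \<subseteq> pverts (grid (a + b) m)"
      using D(1) E(1) by (fastforce simp: cartesian_product_def path_graph_def s_def)
    have "finite E"
      using E(1) by (rule finite_subset) (simp add: cartesian_product_def path_graph_def)
    then have "card (s ` E) \<le> l"
      using E(2) card_image_le le_trans by blast
    then show "card (D \<union> s ` E) \<le> k + l"
      using D(2) card_Un_le[of D "s ` E"] by linarith
    fix v assume v: "v \<in> pverts (grid (a + b) m)"
    obtain i j where ij: "v = (i, j)" by fastforce
    show "v \<in> D \<union> s ` E \<or> (\<exists>u\<in>D \<union> s ` E. (u, v) \<in> parcs (grid (a + b) m))"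
    proof (cases "i < a")
      case True
      then have "v \<in> pverts (grid a m)"
        using v ij by (auto simp: cartesian_product_def path_graph_def)
      then show ?thesis using D(3) arc1 by blast
    next
      case False
      then have "(i - a, j) \<in> pverts (grid b m)" and vs: "v = s (i - a, j)"
        using v ij by (auto simp: cartesian_product_def path_graph_def s_def)
      then consider "(i - a, j) \<in> E" | u where "u \<in> E" "(u, (i - a, j)) \<in> parcs (grid b m)"
        using E(3) by blast
      then show ?thesis
        unfolding vs using arc2 by cases blast+
    qed
  qed
qed

text \<open>A vertex set of a grid with \<open>n\<close> rows is encoded as the list of its columns.  The columns
  \<open>xs\<close> are covered when they are preceded by column \<open>p\<close> and followed by column \<open>q\<close>.\<close>

fun covered :: "nat \<Rightarrow> nat list \<Rightarrow> nat list list \<Rightarrow> nat list \<Rightarrow> bool" where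
  "covered n p [] q \<longleftrightarrow> True"
| "covered n p (c # cs) q \<longleftrightarrow>
     list_all (\<lambda>i. i < n) c \<and>
     list_all (\<lambda>i. i \<in> set c \<or> Suc i \<in> set c \<or> (0 < i \<and> i - 1 \<in> set c) \<or> i \<in> set p
       \<or> i \<in> set (hd (cs @ [q]))) [0..<n] \<and>
     covered n c cs q"

text \<open>Covering a column involves only the adjacent columns, so two blocks interact only
  through the last column of one and the first of the other.\<close>

lemma covered_append:
  "covered n p (xs @ ys) q \<longleftrightarrow>
     covered n p xs (hd (ys @ [q])) \<and> covered n (last (p # xs)) ys q"
proof (induction xs arbitrary: p)
  case (Cons c cs)
  have "hd ((cs @ ys) @ [q]) = hd (cs @ [hd (ys @ [q])])"
    by (cases cs) auto
  with Cons show ?case by simp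
qed simp

text \<open>Since the prefix \<open>P\<close> ends like the period \<open>B\<close>, every later
  block sees the same preceding column, and the column after a block can only be \<open>hd B\<close>
  or \<open>hd C\<close>. So finitely many checks settle every \<open>k\<close>. An empty
  \<open>P\<close> counts as ending with an empty column.\<close>

lemma covered_pump:
  assumes "B \<noteq> []" "C \<noteq> []" "last ([] # P) = last B"
    and "covered n [] P (hd B)" "covered n [] P (hd C)"
    and "covered n (last B) B (hd B)" "covered n (last B) B (hd C)" "covered n (last B) C []"
  shows "covered n [] (P @ concat (replicate k B) @ C) []"
proof -
  let ?X = "\<lambda>k. concat (replicate k B) @ C"
  have hd_X: "hd (?X k @ [[]]) = hd (?X k)" for k
    using assms(2) by (simp add: hd_append)
  have X: "covered n (last B) (?X k) [] \<and> hd (?X k) \<in> {hd B, hd C}" for k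
  proof (induction k)
    case (Suc k)
    have "covered n (last B) (B @ ?X k) []"
      unfolding covered_append[of n "last B" B] hd_X using Suc assms by auto
    then show ?case using assms(1) by simp
  qed (use assms in simp)
  show ?thesis
    unfolding covered_append[of n "[]" P] hd_X using X[of k] assms by auto
qed

lemma covered_nth:
  assumes "covered n p xs q" "j < length xs"
  shows "set (xs ! j) \<subseteq> {..<n}"
    and "i < n \<Longrightarrow> i \<in> set (xs ! j) \<or> Suc i \<in> set (xs ! j) \<or> (0 < i \<and> i - 1 \<in> set (xs ! j))
      \<or> i \<in> set (if j = 0 then p else xs ! (j - 1))
      \<or> i \<in> set (if Suc j < length xs then xs ! Suc j else q)"
proof -
  show "set (xs ! j) \<subseteq> {..<n}"
    using assms
  proof (induction n p xs q arbitrary: j rule: covered.induct)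
    case (2 n p c cs q)
    then show ?case by (cases j) (auto simp: list_all_iff)
  qed simp
  show "i < n \<Longrightarrow> i \<in> set (xs ! j) \<or> Suc i \<in> set (xs ! j) \<or> (0 < i \<and> i - 1 \<in> set (xs ! j))
      \<or> i \<in> set (if j = 0 then p else xs ! (j - 1))
      \<or> i \<in> set (if Suc j < length xs then xs ! Suc j else q)"
    using assms
  proof (induction n p xs q arbitrary: j rule: covered.induct)
    case (2 n p c cs q)
    show ?case
    proof (cases j)
      case 0
      then show ?thesis
        using 2 by (cases cs) (auto simp: list_all_iff)
    next
      case (Suc k)
      then show ?thesis
        using 2(1)[of k] 2(2-) by (cases k) auto
    qed
  qed simp
qed

lemma dominable_covered:
  assumes "covered n [] xs []"
  shows "dominable (grid n (length xs)) (sum_list (map length xs))"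
proof -
  define D where "D = (\<Union>j<length xs. (\<lambda>i. (i, j)) ` set (xs ! j))"
  show ?thesis
    unfolding dominable_def
  proof (intro exI[of _ D] conjI ballI)
    show "D \<subseteq> pverts (grid n (length xs))"
      using covered_nth(1)[OF assms]
      by (fastforce simp: D_def cartesian_product_def path_graph_def)
    have "card D \<le> (\<Sum>j<length xs. card ((\<lambda>i. (i, j)) ` set (xs ! j)))"
      unfolding D_def by (rule card_UN_le) simp
    also have "\<dots> \<le> (\<Sum>j<length xs. length (xs ! j))"
      by (intro sum_mono) (metis card_image_le card_length finite_set le_trans)
    also have "\<dots> = sum_list (map length xs)"
      by (simp add: sum_list_sum_nth atLeast0LessThan)
    finally show "card D \<le> sum_list (map length xs)" .
    fix v assume "v \<in> pverts (grid n (length xs))"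
    then obtain i j where v: "v = (i, j)" "i < n" "j < length xs"
      by (auto simp: cartesian_product_def path_graph_def)
    have D: "(i', j') \<in> D \<longleftrightarrow> j' < length xs \<and> i' \<in> set (xs ! j')" for i' j'
      by (auto simp: D_def)
    have lt: "i' < n" if "i' \<in> set (xs ! j')" "j' < length xs" for i' j'
      using covered_nth(1)[OF assms that(2)] that(1) by auto
    consider "i \<in> set (xs ! j)" | "Suc i \<in> set (xs ! j)" | "0 < i" "i - 1 \<in> set (xs ! j)"
      | "j > 0" "i \<in> set (xs ! (j - 1))" | "Suc j < length xs" "i \<in> set (xs ! Suc j)"
      using covered_nth(2)[OF assms v(3,2)] by (auto split: if_splits)
    then show "v \<in> D \<or> (\<exists>u\<in>D. (u, v) \<in> parcs (grid n (length xs)))"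
    proof cases
      case 1
      then show ?thesis using v D by simp
    next
      case 2
      then have "((Suc i, j), v) \<in> parcs (grid n (length xs))"
        using v lt[OF 2] by (auto simp: cartesian_product_def path_graph_def)
      then show ?thesis using 2 v D by blast
    next
      case 3
      then have "((i - 1, j), v) \<in> parcs (grid n (length xs))"
        using v by (auto simp: cartesian_product_def path_graph_def)
      then show ?thesis using 3 v D by blast
    next
      case 4
      then have "((i, j - 1), v) \<in> parcs (grid n (length xs))"
        using v by (auto simp: cartesian_product_def path_graph_def)
      moreover have "(i, j - 1) \<in> D"
        using 4 v D by auto
      ultimately show ?thesis by blast
    next
      case 5
      then have "((i, Suc j), v) \<in> parcs (grid n (length xs))"
        using v by (auto simp: cartesian_product_def path_graph_def)
      then show ?thesis using 5 D by blast
    qed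
  qed
qed

lemma dominable_coveredI:
  assumes "covered n [] xs []" "length xs = m" "sum_list (map length xs) \<le> k"
  shows "dominable (grid n m) k"
  using dominable_le[OF dominable_covered[OF assms(1)] assms(3)] assms(2) by simp

lemma dominable_pump:
  assumes "B \<noteq> []" "C \<noteq> []" "last ([] # P) = last B"
    and "covered n [] P (hd B)" "covered n [] P (hd C)"
    and "covered n (last B) B (hd B)" "covered n (last B) B (hd C)" "covered n (last B) C []"
    and "m = length P + k * length B + length C"
    and "sum_list (map length P) + k * sum_list (map length B) + sum_list (map length C) \<le> l"
  shows "dominable (grid n m) l"
proof -
  have "sum_list (map length (concat (replicate k B))) = k * sum_list (map length B)"
    "length (concat (replicate k B)) = k * length B"
    by (induction k) auto
  with dominable_covered[OF covered_pump[OF assms(1-8), of k]] assms(9,10) show ?thesis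
    by (auto intro: dominable_le simp: add.assoc)
qed

section \<open>Grids with few rows\<close>

lemma dominable_one: "dominable (grid 1 m) ((m + 2) div 3)"
proof (induction m rule: less_induct)
  case (less m)
  consider "m = 0" | "m = 1" | "m = 2" | "m \<ge> 3" by linarith
  then show ?case
  proof cases
    case 1
    then show ?thesis by (intro dominable_coveredI[of _ "[]"]) simp_all
  next
    case 2
    then show ?thesis using dominable_covered[of 1 "[[0]]"] by simp
  next
    case 3
    then show ?thesis by (intro dominable_coveredI[of _ "[[0], []]"])
        (simp_all add: upt_rec)
  next
    case 4
    \<comment> \<open>Three consecutive vertices are dominated by the middle one. The path is turned
      on its side because \<open>dominable_stack\<close> adds rows.\<close>
    have "dominable (grid 1 3) 1"
      by (intro dominable_coveredI[of _ "[[], [0], []]"])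
        (simp_all add: upt_rec)
    then have "dominable (grid (m - 3 + 3) 1) ((m - 3 + 2) div 3 + 1)"
      using less.IH[of "m - 3"] 4 by (intro dominable_stack dominable_swap[of "path_graph 1"]) auto
    moreover have "m - 3 + 3 = m" "(m - 3 + 2) div 3 + 1 = (m + 2) div 3"
      using 4 by auto
    ultimately show ?thesis
      using dominable_swap by metis
  qed
qed

text \<open>The period has 2 vertices in 4 columns, a density of one quarter; the \<open>+ 1\<close>
  pays for the ending. Taking \<open>k\<close> from \<open>m - 1\<close> makes the ending one to
  four columns long, never empty, as \<open>dominable_pump\<close> requires.\<close>

lemma dominable_two:
  assumes "m \<ge> 1"
  shows "dominable (grid 2 m) (2 * m div 4 + 1)"
proof -
  define k where "k = (m - 1) div 4"
  consider "m = 4 * k + 1" | "m = 4 * k + 2" | "m = 4 * k + 3" | "m = 4 * k + 4"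
    using assms unfolding k_def by linarith
  then show ?thesis
  proof cases
    case 1
    show ?thesis
      by (rule dominable_pump[of "[[0], [], [1], []]" "[[0]]"
            "[]" _ _ k])
        (simp_all add: 1 upt_rec)
  next
    case 2
    show ?thesis
      by (rule dominable_pump[of "[[0], [], [1], []]" "[[0], [0]]"
            "[]" _ _ k])
        (simp_all add: 2 upt_rec)
  next
    case 3
    show ?thesis
      by (rule dominable_pump[of "[[0], [], [1], []]" "[[0], [], [1]]"
            "[]" _ _ k])
        (simp_all add: 3 upt_rec)
  next
    case 4
    show ?thesis
      by (rule dominable_pump[of "[[0], [], [1], []]" "[[0], [], [1], [1]]"
            "[]" _ _ k])
        (simp_all add: 4 upt_rec)
  qed
qed

lemma dominable_three:
  assumes "m \<ge> 1"
  shows "dominable (grid 3 m) (3 * m div 4 + 1)"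
proof -
  define k where "k = (m - 1) div 4"
  consider "m = 4 * k + 1" | "m = 4 * k + 2" | "m = 4 * k + 3" | "m = 4 * k + 4"
    using assms unfolding k_def by linarith
  then show ?thesis
  proof cases
    case 1
    show ?thesis
      by (rule dominable_pump[of "[[1], [], [0, 2], []]" "[[1]]"
            "[]" _ _ k])
        (simp_all add: 1 upt_rec)
  next
    case 2
    show ?thesis
      by (rule dominable_pump[of "[[1], [], [0, 2], []]" "[[1], [1]]"
            "[]" _ _ k])
        (simp_all add: 2 upt_rec)
  next
    case 3
    show ?thesis
      by (rule dominable_pump[of "[[1], [], [0, 2], []]" "[[1], [], [0, 2]]"
            "[]" _ _ k])
        (simp_all add: 3 upt_rec)
  next
    case 4
    show ?thesis
      by (rule dominable_pump[of "[[1], [], [0, 2], []]" "[[1], [], [0, 2], [1]]"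
            "[]" _ _ k])
        (simp_all add: 4 upt_rec)
  qed
qed

text \<open>Again of density one quarter, with 5 vertices in 4 columns. Both ends now need care: the
  prefix is the period without its first column, and the ending depends on \<open>m\<close> modulo
  4.\<close>

lemma dominable_five_large:
  assumes "m \<ge> 8"
  shows "dominable (grid 5 m) (5 * m div 4 + 1)"
proof -
  define k where "k = (m - 8) div 4"
  consider "m = 4 * k + 8" | "m = 4 * k + 9" | "m = 4 * k + 10" | "m = 4 * k + 11"
    using assms unfolding k_def by linarith
  then show ?thesis
  proof cases
    case 1
    show ?thesis
      by (rule dominable_pump[of "[[1], [2, 4], [0], [3]]" "[[1, 3]]"
            "[[2, 4], [0], [3]]" _ _ "k + 1"])
        (simp_all add: 1 upt_rec)
  next
    case 2
    show ?thesis
      by (rule dominable_pump[of "[[1], [2, 4], [0], [3]]" "[[1], [1, 4]]"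
            "[[2, 4], [0], [3]]" _ _ "k + 1"])
        (simp_all add: 2 upt_rec)
  next
    case 3
    show ?thesis
      by (rule dominable_pump[of "[[1], [2, 4], [0], [3]]" "[[1], [0, 4], [2]]"
            "[[2, 4], [0], [3]]" _ _ "k + 1"])
        (simp_all add: 3 upt_rec)
  next
    case 4
    show ?thesis
      by (rule dominable_pump[of "[[1], [2, 4], [0], [3]]" "[[1], [4], [0, 2], [4], [1], [3], [0, 4], [2]]"
            "[[2, 4], [0], [3]]" _ _ k])
        (simp_all add: 4 upt_rec)
  qed
qed

lemma dominable_five:
  assumes "m \<ge> 1"
  shows "dominable (grid 5 m) (5 * m div 4 + 1)"
proof -
  consider "m = 1" | "m = 2" | "m = 3" | "m = 4" | "m = 5" | "m = 6" | "m = 7" | "m \<ge> 8"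
    using assms by linarith
  then show ?thesis
  proof cases
    case 1
    then show ?thesis
      using dominable_swap[OF dominable_one[of 5]] by (simp add: numeral_2_eq_2)
  next
    case 2
    then show ?thesis
      using dominable_swap[OF dominable_two[of 5]] by simp
  next
    case 3
    then show ?thesis
      using dominable_swap[OF dominable_three[of 5]] by simp
  next
    case 4
    then show ?thesis
      by (intro dominable_coveredI[of _ "[[2, 4], [0], [3], [1, 3]]"])
        (simp_all add: upt_rec)
  next
    case 5
    then show ?thesis
      by (intro dominable_coveredI[of _ "[[1], [3, 4], [0], [2], [0, 4]]"])
        (simp_all add: upt_rec)
  next
    case 6
    then show ?thesis
      by (intro dominable_coveredI[of _ "[[2, 4], [0], [3], [1], [0, 4], [2]]"])
        (simp_all add: upt_rec)
  next
    case 7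
    then show ?thesis
      by (intro dominable_coveredI[of _ "[[1], [3, 4], [0], [2], [4], [0, 1], [3]]"])
        (simp_all add: upt_rec)
  next
    case 8
    then show ?thesis by (rule dominable_five_large)
  qed
qed

text \<open>One vertex per column, with no \<open>+ 1\<close>: this exact count lets
  \<open>dominable_grid\<close> add four rows without loss.\<close>

lemma dominable_four:
  assumes "m \<ge> 4" "m \<notin> {5, 6, 9}"
  shows "dominable (grid 4 m) m"
  using assms
proof (induction m rule: less_induct)
  case (less m)
  \<comment> \<open>The base lengths are the admissible lengths for which \<open>m - 4\<close> is
    not admissible.\<close>
  consider "m = 4" | "m = 7" | "m = 10" | "m = 13" | "m - 4 \<ge> 4" "m - 4 \<notin> {5, 6, 9}"
    using less.prems by fastforce
  then show ?case
  proof cases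
    case 1
    then show ?thesis
      by (intro dominable_coveredI[of _ "[[1], [3], [0], [2]]"])
        (simp_all add: upt_rec)
  next
    case 2
    then show ?thesis
      by (intro dominable_coveredI[of _ "[[1], [3], [0], [2], [0], [3], [1]]"])
        (simp_all add: upt_rec)
  next
    case 3
    then show ?thesis
      by (intro dominable_coveredI[of _ "[[1], [3], [0], [2], [0], [3], [1], [3], [0], [2]]"])
        (simp_all add: upt_rec)
  next
    case 4
    then show ?thesis
      by (intro dominable_coveredI[of _ "[[1], [3], [0], [2], [0], [3], [1], [3], [0], [2], [0], [3], [1]]"])
        (simp_all add: upt_rec)
  next
    case 5
    have "dominable (grid 4 4) 4"
      by (rule dominable_coveredI[of _ "[[1], [3], [0], [2]]"])
        (simp_all add: upt_rec)
    moreover have "dominable (grid (m - 4) 4) (m - 4)"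
      by (rule dominable_swap, rule less.IH) (use 5 in auto)
    ultimately have "dominable (grid (m - 4 + 4) 4) (m - 4 + 4)"
      by (intro dominable_stack)
    then show ?thesis
      using less.prems(1) dominable_swap by simp
  qed
qed

text \<open>Four extra rows over an admissible width \<open>b\<close> cost exactly \<open>b\<close>,
  so the floor and the \<open>+ 1\<close> survive the induction. What remains are grids with a side
  of at most 5, and those with both sides in \<open>{6, 9}\<close>, which are cut into strips of
  three rows.\<close>

lemma dominable_grid:
  assumes "n \<ge> 2" "m \<ge> 2"
  shows "dominable (grid n m) (n * m div 4 + 1)"
  using assms
proof (induction "n + m" arbitrary: n m rule: less_induct)
  case less
  have narrow: "dominable (grid a b) (a * b div 4 + 1)" if "a \<in> {2, 3, 5}" "b \<ge> 2" for a b
    using that dominable_two[of b] dominable_three[of b] dominable_five[of b] by auto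
  have swap: "dominable (grid a b) (a * b div 4 + 1)"
    if "dominable (grid b a) (b * a div 4 + 1)" for a b
    using dominable_swap[OF that] by (simp add: mult.commute)
  have four: "dominable (grid 4 b) (4 * b div 4 + 1)" if "b \<ge> 2" for b
  proof -
    have four_four: "dominable (grid 4 4) 4"
      by (rule dominable_four) auto
    have "dominable (grid b 4) (b * 4 div 4 + 1)" if "b \<in> {6, 9}"
      using that dominable_stack[OF four_four narrow[of 2 4]]
        dominable_stack[OF four_four narrow[of 5 4]] by auto
    moreover have "dominable (grid b 4) (b * 4 div 4 + 1)" if "b \<in> {2, 3, 5}"
      by (rule narrow) (use that in auto)
    moreover have "dominable (grid 4 b) (4 * b div 4 + 1)" if "b \<ge> 4" "b \<notin> {5, 6, 9}"
      using dominable_four[OF that] by (rule dominable_le) simp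
    ultimately show ?thesis
      using \<open>b \<ge> 2\<close> swap[of b 4] by fastforce
  qed
  have add_four: "dominable (grid a b) (a * b div 4 + 1)"
    if "a + b = n + m" "a \<ge> 6" "b \<ge> 4" "b \<notin> {5, 6, 9}" for a b
  proof -
    have "dominable (grid (a - 4 + 4) b) ((a - 4) * b div 4 + 1 + b)"
      using that less.hyps[of "a - 4" b] by (intro dominable_stack dominable_four) auto
    moreover have "a * b = (a - 4) * b + b * 4"
      using that(2) by (simp add: algebra_simps flip: add_mult_distrib2)
    then have "(a - 4) * b div 4 + 1 + b = a * b div 4 + 1"
      by simp
    ultimately show ?thesis
      using that(2) by simp
  qed
  have six: "dominable (grid 6 b) (6 * b div 4 + 1)" if "b \<in> {6, 9}" for b
    using that dominable_stack[OF narrow[of 3 b] narrow[of 3 b]] by auto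
  have nine: "dominable (grid 9 9) (9 * 9 div 4 + 1)"
    using dominable_stack[OF six[of 9] narrow[of 3 9]] by simp
  consider "n \<in> {2, 3, 5}" | "m \<in> {2, 3, 5}" | "n = 4" | "m = 4"
    | "n \<ge> 6" "m \<ge> 6" "m \<notin> {6, 9}" | "n \<ge> 6" "m \<ge> 6" "n \<notin> {6, 9}"
    | "n \<in> {6, 9}" "m \<in> {6, 9}"
    using less.prems by force
  then show ?case
  proof cases
    case 1
    then show ?thesis using narrow less.prems by blast
  next
    case 2
    then show ?thesis using narrow less.prems swap by blast
  next
    case 3
    then show ?thesis using four less.prems by blast
  next
    case 4
    then show ?thesis using four less.prems swap by blast
  next
    case 5
    then show ?thesis using add_four by simp
  next
    case 6
    then show ?thesis using add_four[of m n] swap by simp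
  next
    case 7
    then show ?thesis using six nine swap by blast
  qed
qed

text \<open>Along the cycle \<open>J\<close>, each fibre contains every fourth vertex, at residue 0
  or 2 by the parity of the \<open>K\<close>-coordinate. It dominates three residues of itself, and
  a neighbouring fibre dominates the fourth. Only path edges of \<open>K\<close> are called upon, so
  an odd cycle \<open>K\<close>, where parity cannot alternate all the way round, does no
  harm.\<close>

lemma dominable_cycle:
  assumes "parcs J = parcs (cycle_graph (4 * k))" "pverts J = {..<4 * k}"
    and "parcs (path_graph m) \<subseteq> parcs K" "pverts K = {..<m}" "m \<ge> 2"
  shows "dominable (cartesian_product J K) (k * m)"
proof -
  define x where "x = (\<lambda>j :: nat. if even j then 0 else 2 :: nat)"
  define D where "D = (\<lambda>(i, j). (4 * i + x j, j)) ` ({..<k} \<times> {..<m})"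
  have mem: "(i, j) \<in> D" if "i < 4 * k" "j < m" "i mod 4 = x j" for i j
  proof -
    have "(i, j) = (4 * (i div 4) + x j, j)"
      using that(3) by (metis mult_div_mod_eq)
    moreover have "i div 4 < k"
      using that(1) by auto
    ultimately show ?thesis
      using that(2) unfolding D_def by (intro image_eqI[of _ _ "(i div 4, j)"]) auto
  qed
  show ?thesis
    unfolding dominable_def
  proof (intro exI[of _ D] conjI ballI)
    show "D \<subseteq> pverts (cartesian_product J K)"
      by (auto simp: D_def cartesian_product_def assms x_def)
    show "card D \<le> k * m"
      unfolding D_def using card_image_le[of "{..<k} \<times> {..<m}"] by force
    fix v assume "v \<in> pverts (cartesian_product J K)"
    then obtain i j where v: "v = (i, j)" "i < 4 * k" "j < m"
      by (auto simp: cartesian_product_def assms)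
    \<comment> \<open>The neighbouring fibre is the previous one, or fibre 1 if
      \<open>j = 0\<close>, which exists since \<open>m \<ge> 2\<close>.\<close>
    define j' where "j' = (if j = 0 then 1 else j - 1)"
    have j': "j' < m" "x j' = 2 - x j" "j' = Suc j \<or> j = Suc j'"
      using v assms(5) by (auto simp: j'_def x_def)
    have "i mod 4 \<in> {0, 1, 2, 3}" "x j = 0 \<or> x j = 2" by (auto simp: x_def)
    then consider "i mod 4 = x j" | "i mod 4 = x j'" | "Suc i mod 4 = x j" | "i mod 4 = Suc (x j)"
      using j'(2) by (auto simp: mod_Suc)
    then show "v \<in> D \<or> (\<exists>u\<in>D. (u, v) \<in> parcs (cartesian_product J K))"
    proof cases
      case 1
      then show ?thesis using mem v by blast
    next
      case 2
      have "((i, j'), v) \<in> parcs (cartesian_product J K)"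
        using v j' assms(3) by (auto simp: cartesian_product_def assms path_graph_def)
      then show ?thesis using mem[OF v(2) j'(1) 2] by blast
    next
      case 3
      define i' where "i' = Suc i mod (4 * k)"
      \<comment> \<open>The length is a multiple of 4, so wrapping round the cycle preserves
        residues modulo 4.\<close>
      have "i' mod 4 = x j"
        unfolding i'_def using 3 by (simp add: mod_mod_cancel)
      moreover have "i' < 4 * k"
        unfolding i'_def using v(2) by (intro mod_less_divisor) simp
      moreover have "((i', j), v) \<in> parcs (cartesian_product J K)"
        using v \<open>i' < 4 * k\<close>
        by (auto simp: cartesian_product_def assms cycle_graph_def i'_def)
      ultimately show ?thesis using mem v by blast
    next
      case 4
      then have "i > 0" by (cases i) auto
      then have "((i - 1, j), v) \<in> parcs (cartesian_product J K)"
        using v by (auto simp: cartesian_product_def assms cycle_graph_def)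
      moreover have "(i - 1) mod 4 = x j"
        using 4 by (cases i) (auto simp: mod_Suc split: if_splits)
      ultimately show ?thesis using mem[of "i - 1" j] v by auto
    qed
  qed
qed

section \<open>The first two steps\<close>

text \<open>\<open>A\<close> and \<open>B\<close> are the neighbourhoods in the two factors. The
  coordinate map \<open>p\<close> is abstract so that \<open>swapped\<close> can exchange the
  factors and each argument serves in both directions. Injectivity of \<open>f\<close> records that
  one forcing vertex is chosen per forced vertex.\<close>

locale propagation_step =
  fixes p :: "nat \<Rightarrow> nat \<Rightarrow> 'v" and A B :: "nat \<Rightarrow> nat set"
    and N :: "'v \<Rightarrow> 'v set" and S R :: "'v set" and f :: "'v \<Rightarrow> 'v"
  assumes p_inject [simp]: "p x y = p x' y' \<longleftrightarrow> x = x' \<and> y = y'"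
    and p_surj: "\<exists>x y. v = p x y"
    and N_p: "N (p x y) = (\<lambda>x'. p x' y) ` A x \<union> p x ` B y"
    and sym_A: "x' \<in> A x \<Longrightarrow> x \<in> A x'" and sym_B: "y' \<in> B y \<Longrightarrow> y \<in> B y'"
    and irrefl_A: "x \<notin> A x" and irrefl_B: "y \<notin> B y"
    and two_A: "finite (A x) \<and> card (A x) \<le> 2" and two_B: "finite (B y) \<and> card (B y) \<le> 2"
    and f: "u \<in> R \<Longrightarrow> N u - (S \<union> \<Union> (N ` S)) = {f u}" and f_inj: "inj_on f R"
begin

definition observed :: "'v set" where
  "observed = S \<union> \<Union> (N ` S)"

text \<open>\<open>R\<close> is a set of vertices that force in the second step, and \<open>f u\<close> is the vertex forced by
  \<open>u\<close>.  The vertex \<open>v\<close> of \<open>S\<close> gets the whole weight of a good neighbour \<open>u\<close>.\<close>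

definition good :: "'v \<Rightarrow> 'v \<Rightarrow> bool" where
  "good v u \<longleftrightarrow> u \<in> N v \<and> u \<notin> S \<and> N u \<inter> S = {v} \<and> u \<in> R"

lemma swapped: "propagation_step (\<lambda>x y. p y x) B A N S R f"
proof unfold_locales
  show "\<exists>x y. v = p y x" for v using p_surj[of v] by blast
qed (use f f_inj sym_A sym_B irrefl_A irrefl_B two_A two_B in \<open>auto simp: N_p\<close>)

lemma N_iff:
  "p x y \<in> N (p x' y') \<longleftrightarrow> y = y' \<and> x \<in> A x' \<or> x = x' \<and> y \<in> B y'"
  by (auto simp: N_p)

lemma N_sym: "u \<in> N v \<Longrightarrow> v \<in> N u"
  using p_surj[of u] p_surj[of v] sym_A sym_B by (auto simp: N_iff)

lemma observed_N: "v \<in> S \<Longrightarrow> u \<in> N v \<Longrightarrow> u \<in> observed"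
  by (auto simp: observed_def)

lemma N_finite: "finite (N v)"
  using p_surj[of v] two_A two_B by (auto simp: N_p)

lemma card_N: "card (N (p x y)) = card (A x) + card (B y)"
proof -
  have "card ((\<lambda>x'. p x' y) ` A x \<union> p x ` B y) =
      card ((\<lambda>x'. p x' y) ` A x) + card (p x ` B y)"
    using two_A two_B irrefl_A by (intro card_Un_disjoint) auto
  then show ?thesis
    by (simp add: N_p card_image inj_on_def)
qed

lemma A_eq: "a1 \<in> A a \<Longrightarrow> a2 \<in> A a \<Longrightarrow> a1 \<noteq> a2 \<Longrightarrow> A a = {a1, a2}"
  using two_A[of a] card_seteq[of "A a" "{a1, a2}"] by auto

lemma B_eq: "b1 \<in> B b \<Longrightarrow> b2 \<in> B b \<Longrightarrow> b1 \<noteq> b2 \<Longrightarrow> B b = {b1, b2}"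
  using two_B[of b] card_seteq[of "B b" "{b1, b2}"] by auto

lemma good_private: "good v u \<Longrightarrow> s \<in> S \<Longrightarrow> u \<in> N s \<Longrightarrow> s = v"
  unfolding good_def using N_sym by blast

text \<open>An unobserved corner \<open>(a1, b1)\<close> would be forced by two vertices of \<open>R\<close>; and its dominator
  cannot lie above it, because then nothing would be left for \<open>(a, b1)\<close> to force.\<close>

lemma corner:
  assumes a: "A a = {a1, a2}" "a1 \<noteq> a2" and b: "B b = {b1, b2}" "b1 \<noteq> b2"
    and v: "p a b \<in> S"
    and g: "good (p a b) (p a1 b)" "good (p a b) (p a2 b)" "good (p a b) (p a b1)"
  shows "p a1 b1 \<in> observed" "p a1 b2 \<notin> observed" "\<exists>c\<in>A a1. c \<noteq> a \<and> p c b1 \<in> S"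
proof -
  have fu: "N u - observed = {f u}" if "good w u" for w u
    using that f[of u] unfolding good_def observed_def by auto
  have inA: "a \<in> A a1" "a \<in> A a2" "b \<in> B b1" "b \<in> B b2"
    using a b sym_A sym_B by auto
  have ne: "a1 \<noteq> a" "a2 \<noteq> a" "b1 \<noteq> b" "b2 \<noteq> b"
    using a b irrefl_A irrefl_B by auto
  have obs: "p x b1 \<in> observed" if x: "x \<in> A a" "good (p a b) (p x b)" for x
  proof (rule ccontr)
    assume "p x b1 \<notin> observed"
    moreover have "p x b1 \<in> N (p x b)" "p x b1 \<in> N (p a b1)"
      using x b by (auto simp: N_iff)
    ultimately have "p x b1 \<in> {f (p x b)}" "p x b1 \<in> {f (p a b1)}"
      using fu[OF x(2)] fu[OF g(3)] by blast+
    then have "p x b = p a b1"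
      using f_inj x(2) g(3) unfolding good_def inj_on_def by (metis singletonD)
    then show False using ne by simp
  qed
  show o1: "p a1 b1 \<in> observed" using obs a g by blast
  have o2: "p a2 b1 \<in> observed" using obs a g by blast
  have o3: "p a b \<in> observed" using v by (simp add: observed_def)
  have "p a1 b1 \<notin> S"
    using good_private[OF g(3), of "p a1 b1"] a ne sym_A by (auto simp: N_iff)
  then obtain s where s: "s \<in> S" "p a1 b1 \<in> N s"
    using o1 by (auto simp: observed_def)
  obtain x y where xy: "s = p x y" using p_surj by blast
  have "\<not> (x = a1 \<and> b1 \<in> B y)"
  proof
    assume *: "x = a1 \<and> b1 \<in> B y"
    then have "y \<noteq> b" using s xy g(1) by (auto simp: good_def)
    then have "B b1 = {b, y}" using B_eq inA(3) * sym_B by blast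
    moreover have "A a = {a1, a2}" by fact
    moreover have "p a y \<in> observed"
      using s xy * inA by (intro observed_N[of s]) (auto simp: N_iff)
    ultimately have "N (p a b1) \<subseteq> observed"
      using o1 o2 o3 by (auto simp: N_p)
    then show False using fu[OF g(3)] by blast
  qed
  then have xy': "y = b1" "a1 \<in> A x" using s xy by (auto simp: N_iff)
  have x: "x \<noteq> a" using s xy xy' g(3) by (auto simp: good_def)
  have x': "x \<in> A a1" using xy' sym_A by blast
  then show "\<exists>c\<in>A a1. c \<noteq> a \<and> p c b1 \<in> S" using s xy xy' x by blast
  \<comment> \<open>The vertex \<open>(x, b1)\<close> of \<open>S\<close> observes
    \<open>(x, b)\<close>, so \<open>(a1, b2)\<close> is the only neighbour left for
    \<open>(a1, b)\<close> to force.\<close>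
  show "p a1 b2 \<notin> observed"
  proof
    assume o4: "p a1 b2 \<in> observed"
    have "A a1 = {a, x}" using A_eq inA(1) x x' by blast
    moreover have "p x b \<in> observed"
      using s xy xy' b by (intro observed_N[of s]) (auto simp: N_iff sym_B inA)
    ultimately have "N (p a1 b) \<subseteq> observed"
      using o1 o3 o4 b by (auto simp: N_p)
    then show False using fu[OF g(1)] by blast
  qed
qed

section \<open>The share of a single vertex\<close>

lemma good_finite: "finite {u. good v u}"
  using N_finite by (rule finite_subset[rotated]) (auto simp: good_def)

lemma good_subset: "{u. good v u} \<subseteq> N v"
  by (auto simp: good_def)

lemma two_cases:
  assumes "card (N (p a b)) = 4"
  obtains a1 a2 b1 b2 where "A a = {a1, a2}" "a1 \<noteq> a2" "B b = {b1, b2}" "b1 \<noteq> b2"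
proof -
  have "card (A a) = 2" "card (B b) = 2"
    using assms two_A[of a] two_B[of b] by (auto simp: card_N)
  then show ?thesis using that by (auto simp: card_2_iff)
qed

lemma card_N_le: "card (N v) \<le> 4"
  using p_surj[of v] two_A two_B by (fastforce simp: card_N intro: add_mono[of _ 2 _ 2, simplified])

text \<open>A sum of 8 makes all four neighbours good. Then \<open>corner\<close> applies with
  \<open>b1\<close> and \<open>b2\<close> in either order and declares \<open>(a1, b2)\<close> both
  unobserved and observed.\<close>

lemma card_good_le:
  assumes "v \<in> S"
  shows "card (N v) + card {u. good v u} \<le> 7"
proof (rule ccontr)
  assume "\<not> ?thesis"
  moreover have "card {u. good v u} \<le> card (N v)"
    by (intro card_mono good_subset N_finite)
  ultimately have c: "card (N v) = 4" "card {u. good v u} = card (N v)"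
    using card_N_le[of v] by auto
  then have *: "{u. good v u} = N v"
    using card_subset_eq[OF N_finite good_subset] by metis
  obtain a b where v: "v = p a b" using p_surj by blast
  obtain a1 a2 b1 b2 where ab: "A a = {a1, a2}" "a1 \<noteq> a2" "B b = {b1, b2}" "b1 \<noteq> b2"
    using two_cases c(1) v by metis
  have g: "good v u" if "u \<in> N v" for u using * that by blast
  have "p a1 b2 \<notin> observed"
    by (rule corner(2)[of a a1 a2 b b1 b2]) (use ab assms v g in \<open>auto simp: N_p\<close>)
  moreover have "p a1 b2 \<in> observed"
    by (rule corner(1)[of a a1 a2 b b2 b1]) (use ab assms v g in \<open>auto simp: N_p\<close>)
  ultimately show False by contradiction
qed

text \<open>The vertex \<open>(a, b)\<close> has share 7, and its one neighbour that need not be good is the one in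
  the \<open>B\<close>-direction opposite to \<open>b1\<close>.\<close>

definition zigzag :: "nat \<Rightarrow> nat \<Rightarrow> nat \<Rightarrow> bool" where
  "zigzag a b b1 \<longleftrightarrow> p a b \<in> S \<and> b1 \<in> B b \<and> card (A a) = 2 \<and> card (B b) = 2 \<and>
     (\<forall>x\<in>A a. good (p a b) (p x b)) \<and> good (p a b) (p a b1)"

text \<open>With degree at most 4 and no more good neighbours than neighbours, 7 can only be 4 + 3,
  so exactly one neighbour is not good.\<close>

lemma share_seven:
  assumes "card (N v) + card {u. good v u} = 7"
  shows "card (N v) = 4" and "u1 \<in> N v \<Longrightarrow> u2 \<in> N v \<Longrightarrow> u1 \<noteq> u2 \<Longrightarrow> good v u1 \<or> good v u2"
proof -
  have "card {u. good v u} \<le> card (N v)"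
    by (intro card_mono good_subset N_finite)
  then show c: "card (N v) = 4"
    using card_N_le[of v] assms by auto
  show "good v u1 \<or> good v u2" if "u1 \<in> N v" "u2 \<in> N v" "u1 \<noteq> u2"
  proof (rule ccontr)
    assume "\<not> (good v u1 \<or> good v u2)"
    then have "{u. good v u} \<subseteq> N v - {u1, u2}"
      using good_subset by blast
    then have "card {u. good v u} \<le> card (N v - {u1, u2})"
      by (intro card_mono) (auto simp: N_finite)
    also have "\<dots> = card (N v) - 2"
      using that N_finite by (subst card_Diff_subset) auto
    finally show False using c assms by simp
  qed
qed

text \<open>\<open>corner\<close> yields a vertex \<open>(c, b1)\<close> of \<open>S\<close> a
  knight's move away. Its share is also 7, so just one of its neighbours is not good; ruling out
  three of them leaves the one opposite to \<open>(c, b)\<close>, which is the zigzag shape turned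
  upside down.\<close>

lemma zigzag_propagate:
  assumes nice: "\<And>v. v \<in> S \<Longrightarrow> card (N v) + card {u. good v u} = 7"
    and Z: "zigzag a b b1" and a1: "a1 \<in> A a"
  shows "\<exists>c\<in>A a1. c \<noteq> a \<and> zigzag c b1 b"
proof -
  interpret swap: propagation_step "\<lambda>x y. p y x" B A N S R f by (rule swapped)
  obtain a2 where a: "A a = {a1, a2}" "a1 \<noteq> a2"
    using Z a1 unfolding zigzag_def by (metis card_2_iff insert_commute insertE singletonD)
  obtain b2 where b: "B b = {b1, b2}" "b1 \<noteq> b2"
    using Z unfolding zigzag_def by (metis card_2_iff insert_commute insertE singletonD)
  have S: "p a b \<in> S" and g: "good (p a b) (p a1 b)" "good (p a b) (p a2 b)"
      "good (p a b) (p a b1)"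
    using Z a by (auto simp: zigzag_def)
  note cor = corner[OF a b S g]
  obtain c where c: "c \<in> A a1" "c \<noteq> a" "p c b1 \<in> S" using cor(3) by blast
  let ?w = "p c b1"
  note nw = share_seven[OF nice[OF c(3)]]
  have "a1 \<in> A c" using c sym_A by blast
  moreover have "card (A c) = 2" "card (B b1) = 2"
    using nw(1) two_A[of c] two_B[of b1] by (auto simp: card_N)
  ultimately obtain c' where c': "A c = {a1, c'}" "a1 \<noteq> c'"
    by (metis card_2_iff insert_commute insertE singletonD)
  have "b \<in> B b1" using b sym_B by blast
  then obtain b1' where b': "B b1 = {b, b1'}" "b \<noteq> b1'"
    using \<open>card (B b1) = 2\<close> by (metis card_2_iff insert_commute insertE singletonD)
  have N: "N ?w = {p a1 b1, p c' b1, p c b, p c b1'}"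
    by (auto simp: N_p c' b')
  have ne: "a1 \<noteq> c" "c' \<noteq> c" "b \<noteq> b1" "b1' \<noteq> b1"
    using c' b' irrefl_A irrefl_B by auto
  \<comment> \<open>Otherwise \<open>corner\<close> with the factors exchanged makes
    \<open>(a1, b)\<close> unobserved, although it is adjacent to \<open>(a, b)\<close> in
    \<open>S\<close>.\<close>
  have east: "good ?w (p a1 b1)"
  proof (rule ccontr)
    assume n: "\<not> ?thesis"
    have "good ?w u" if "u \<in> {p c' b1, p c b, p c b1'}" for u
      using nw(2)[of "p a1 b1" u] n that N c' ne by auto
    then have "p a1 b \<notin> observed"
      using swap.corner(2)[of b1 b b1' c c' a1] c c' b' by auto
    then show False using observed_N[OF S, of "p a1 b"] a1 by (simp add: N_iff)
  qed
  \<comment> \<open>Otherwise the exchanged \<open>corner\<close> puts the unobserved vertex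
    \<open>(a1, b2)\<close> into \<open>S\<close>.\<close>
  have west: "good ?w (p c' b1)"
  proof (rule ccontr)
    assume n: "\<not> ?thesis"
    have "good ?w u" if "u \<in> {p a1 b1, p c b, p c b1'}" for u
      using nw(2)[of "p c' b1" u] n that N c' ne by auto
    then have "\<exists>d\<in>B b. d \<noteq> b1 \<and> p a1 d \<in> S"
      using swap.corner(3)[of b1 b b1' c a1 c'] c c' b' by auto
    then have "p a1 b2 \<in> S" using b by auto
    then show False using cor(2) by (auto simp: observed_def)
  qed
  \<comment> \<open>Otherwise \<open>(a, b1')\<close> lies in \<open>S\<close> and is a second
    dominator of \<open>(a, b1)\<close>, whose only neighbour in \<open>S\<close> is
    \<open>(a, b)\<close>.\<close>
  have vert: "good ?w (p c b)"
  proof (rule ccontr)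
    assume n: "\<not> ?thesis"
    have "good ?w u" if "u \<in> {p a1 b1, p c' b1, p c b1'}" for u
      using nw(2)[of "p c b" u] n that N b' ne by auto
    then have "\<exists>d\<in>A a1. d \<noteq> c \<and> p d b1' \<in> S"
      using corner(3)[of c a1 c' b1 b1' b] c c' b' by (auto simp: insert_commute)
    moreover have "A a1 = {a, c}"
      using A_eq[of a a1 c] a c sym_A by auto
    ultimately have "p a b1' \<in> S" by auto
    moreover have "p a b1 \<in> N (p a b1')"
      using b' sym_B by (auto simp: N_iff)
    ultimately have "p a b1' = p a b"
      using good_private[OF g(3)] by blast
    then show False using b' by simp
  qed
  have "zigzag c b1 b"
    unfolding zigzag_def using c(3) b' c' east west vert \<open>card (A c) = 2\<close> \<open>card (B b1) = 2\<close> by auto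
  then show ?thesis using c by blast
qed

end

section \<open>Counting shares and following the zigzag\<close>

context propagation_step
begin

text \<open>Double counting of adjacent pairs of a vertex of \<open>S\<close> and an observed vertex
  \<open>u\<close> outside \<open>S\<close>, each pair weighing 1, or 2 if good. If \<open>u\<close>
  in \<open>R\<close> has one neighbour in \<open>S\<close>, the pair is good; if it has several,
  these already give 2.\<close>

lemma card_observed_forcing_le:
  assumes "finite S" "R \<subseteq> observed - S"
  shows "card (observed - S) + card R \<le> (\<Sum>v\<in>S. card (N v) + card {u. good v u})"
proof -
  let ?Q = "observed - S"
  have fin: "finite ?Q" "finite R"
    using assms N_finite by (auto simp: observed_def intro: finite_subset)
  have "?Q \<inter> R = R" using assms(2) by blast
  then have "card ?Q + card R = (\<Sum>u\<in>?Q. 1 + (if u \<in> R then 1 else 0))"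
    unfolding sum.distrib using fin by (simp add: sum.If_cases)
  also have "\<dots> \<le> (\<Sum>u\<in>?Q. \<Sum>v | v \<in> S \<and> u \<in> N v. 1 + (if good v u then 1 else 0))"
  proof (rule sum_mono)
    fix u assume u: "u \<in> ?Q"
    let ?D = "{v \<in> S. u \<in> N v}"
    have "finite ?D" using assms(1) by simp
    have D: "?D = N u \<inter> S" using N_sym by blast
    obtain v where v: "v \<in> ?D" using u by (auto simp: observed_def)
    show "(1 :: nat) + (if u \<in> R then 1 else 0) \<le> (\<Sum>v\<in>?D. 1 + (if good v u then 1 else 0))"
    proof (cases "?D = {v}")
      case True
      then have "N u \<inter> S = {v}" using D by simp
      then have "u \<in> R \<longrightarrow> good v u"
        using u v unfolding good_def by blast
      then show ?thesis unfolding True by simp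
    next
      case False
      then obtain v' where "v' \<in> ?D" "v' \<noteq> v" using v by blast
      then have "card {v, v'} \<le> card ?D"
        using v \<open>finite ?D\<close> by (intro card_mono) auto
      then have "2 \<le> card ?D" using \<open>v' \<noteq> v\<close> by simp
      also have "\<dots> = (\<Sum>v\<in>?D. 1)" by simp
      also have "\<dots> \<le> (\<Sum>v\<in>?D. 1 + (if good v u then 1 else 0))"
        by (rule sum_mono) simp
      finally show ?thesis by simp
    qed
  qed
  also have "\<dots> = (\<Sum>v\<in>S. \<Sum>u | u \<in> ?Q \<and> u \<in> N v. 1 + (if good v u then 1 else 0))"
    using fin(1) assms(1) by (rule sum.swap_restrict)
  also have "\<dots> \<le> (\<Sum>v\<in>S. card (N v) + card {u. good v u})"
  proof (rule sum_mono)
    fix v assume "v \<in> S"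
    let ?E = "{u \<in> ?Q. u \<in> N v}"
    have "finite ?E" by (rule finite_subset[OF _ fin(1)]) blast
    then have "(\<Sum>u\<in>?E. 1 + (if good v u then 1 else 0)) = card ?E + card {u \<in> ?E. good v u}"
      unfolding sum.distrib by (simp add: sum.If_cases Int_def)
    also have "\<dots> \<le> card (N v) + card {u. good v u}"
      using N_finite good_finite by (intro add_mono card_mono) auto
    finally show "(\<Sum>u\<in>?E. 1 + (if good v u then 1 else 0)) \<le> card (N v) + card {u. good v u}" .
  qed
  finally show ?thesis .
qed

text \<open>At most one neighbour is not good, so one of the two opposite pairs is entirely good;
  its direction decides whether the factors have to be exchanged.\<close>

lemma ex_zigzag:
  assumes "v \<in> S" and nice: "card (N v) + card {u. good v u} = 7"
  shows "(\<exists>a b b1. zigzag a b b1) \<or> (\<exists>a b a1. propagation_step.zigzag (\<lambda>x y. p y x) B A N S R b a a1)"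
proof -
  interpret swap: propagation_step "\<lambda>x y. p y x" B A N S R f by (rule swapped)
  note nw = share_seven[OF nice]
  obtain a b where v: "v = p a b" using p_surj by blast
  obtain a1 a2 b1 b2 where ab: "A a = {a1, a2}" "a1 \<noteq> a2" "B b = {b1, b2}" "b1 \<noteq> b2"
    using two_cases nw(1) v by metis
  have N: "N v = {p a1 b, p a2 b, p a b1, p a b2}"
    by (auto simp: v N_p ab)
  have ne: "a1 \<noteq> a" "a2 \<noteq> a" "b1 \<noteq> b" "b2 \<noteq> b"
    using ab irrefl_A irrefl_B by auto
  have c: "card (A a) = 2" "card (B b) = 2" using ab by auto
  have *: "u1 \<in> N v \<Longrightarrow> u2 \<in> N v \<Longrightarrow> u1 \<noteq> u2 \<Longrightarrow> good v u1 \<or> good v u2" for u1 u2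
    by (rule nw(2))
  have 1: "good v (p a1 b) \<or> good v (p a2 b)" "good v (p a b1) \<or> good v (p a b2)"
      "good v (p a1 b) \<or> good v (p a b1)" "good v (p a1 b) \<or> good v (p a b2)"
      "good v (p a2 b) \<or> good v (p a b1)" "good v (p a2 b) \<or> good v (p a b2)"
    using ab ne by (intro *; simp add: N)+
  consider "good v (p a1 b)" "good v (p a2 b)" | "good v (p a b1)" "good v (p a b2)"
    using 1 by blast
  then show ?thesis
  proof cases
    case 1
    then have "zigzag a b b1 \<or> zigzag a b b2"
      using \<open>good v (p a b1) \<or> good v (p a b2)\<close> c assms(1) v ab by (auto simp: zigzag_def)
    then show ?thesis by blast
  next
    case 2
    then have "swap.zigzag b a a1 \<or> swap.zigzag b a a2"
      using \<open>good v (p a1 b) \<or> good v (p a2 b)\<close> c assms(1) v ab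
      by (auto simp: swap.zigzag_def)
    then show ?thesis by blast
  qed
qed

text \<open>A zigzag vertex has two neighbours along the path, so it is not at the right end, and
  \<open>zigzag_propagate\<close> finds another one two places further right; this cannot go on for
  ever.\<close>

lemma no_zigzag_path:
  assumes nice: "\<And>v. v \<in> S \<Longrightarrow> card (N v) + card {u. good v u} = 7"
    and A: "\<And>x. A x = {x'. x < n \<and> x' < n \<and> (x' = Suc x \<or> x = Suc x')}"
  shows "\<not> zigzag a b b1"
proof (induction "n - a" arbitrary: a b b1 rule: less_induct)
  case less
  show ?case
  proof
    assume Z: "zigzag a b b1"
    have "Suc a \<in> A a"
    proof (rule ccontr)
      assume "Suc a \<notin> A a"
      then have "A a \<subseteq> {a - 1}" by (auto simp: A)
      then have "card (A a) \<le> 1" using card_mono[of "{a - 1}" "A a"] by simp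
      then show False using Z by (simp add: zigzag_def)
    qed
    then obtain c where c: "c \<in> A (Suc a)" "c \<noteq> a" "zigzag c b1 b"
      using zigzag_propagate[OF nice Z] by blast
    then have "n - c < n - a" by (auto simp: A)
    then show False using less.hyps c(3) by blast
  qed
qed

text \<open>Two places further the zigzag has \<open>b\<close> and \<open>b1\<close> exchanged, and
  after four it is back at \<open>b\<close>. Going round the cycle in steps of four overshoots the
  start by \<open>r = 4 - n mod 4\<close>, and the vertex of \<open>S\<close> found there conflicts
  with a good vertex near the start.\<close>

lemma no_zigzag_cycle:
  assumes nice: "\<And>v. v \<in> S \<Longrightarrow> card (N v) + card {u. good v u} = 7"
    and A: "\<And>x. A x = {x'. x < n \<and> x' < n \<and> (x' = Suc x mod n \<or> x = Suc x' mod n)}"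
    and n: "n \<ge> 3" "n mod 4 \<noteq> 0"
  shows "\<not> zigzag a b b1"
proof
  assume Z: "zigzag a b b1"
  have in_A: "a < n" if "zigzag a b b1" for a b b1
    using that A[of a] by (cases "a < n") (auto simp: zigzag_def)
  have two: "zigzag ((a + 2) mod n) b1 b" if Z: "zigzag a b b1" for a b b1
  proof -
    have "a < n" using in_A Z .
    then have "Suc a mod n \<in> A a" using n by (auto simp: A)
    then obtain c where c: "c \<in> A (Suc a mod n)" "c \<noteq> a" "zigzag c b1 b"
      using zigzag_propagate[OF nice Z] by blast
    have "c < n" using c by (auto simp: A)
    have "c = Suc (Suc a mod n) mod n \<or> Suc a mod n = Suc c mod n"
      using c by (auto simp: A)
    moreover have "Suc a mod n \<noteq> Suc c mod n"
      using c(2) \<open>a < n\<close> \<open>c < n\<close> by (auto simp: mod_Suc split: if_splits)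
    ultimately have "c = (a + 2) mod n" by (simp add: mod_Suc_eq)
    then show ?thesis using c by simp
  qed
  have four: "zigzag ((a + 4 * j) mod n) b b1" for j
  proof (induction j)
    case 0
    then show ?case using Z in_A[OF Z] by simp
  next
    case (Suc j)
    have "(((a + 4 * j) mod n + 2) mod n + 2) mod n = (a + 4 * j + 2 + 2) mod n"
      by (simp only: mod_add_left_eq)
    also have "a + 4 * j + 2 + 2 = a + 4 * Suc j" by simp
    finally show ?case using two[OF two[OF Suc]] by simp
  qed
  define r where "r = 4 - n mod 4"
  have "n mod 4 < 4" by simp
  then consider "r = 1" | "r = 2" | "r = 3" using n(2) unfolding r_def by linarith
  note r_cases = this
  have "4 * (n div 4 + 1) = n + r"
  proof -
    have "n mod 4 + r = 4" unfolding r_def using \<open>n mod 4 < 4\<close> by simp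
    moreover have "4 * (n div 4) + n mod 4 = n" by simp
    ultimately have "4 * (n div 4) + 4 = n + r" by linarith
    then show ?thesis by simp
  qed
  then have "a + 4 * (n div 4 + 1) = a + r + n" by simp
  then have Zr: "zigzag ((a + r) mod n) b b1"
    using four[of "n div 4 + 1"] by (metis mod_add_self2)
  then have S: "p ((a + r) mod n) b \<in> S" by (simp add: zigzag_def)
  have a: "a < n" using in_A Z .
  have A1: "Suc a mod n \<in> A a" using a n by (auto simp: A)
  then have g: "good (p a b) (p (Suc a mod n) b)" using Z by (simp add: zigzag_def)
  have A12: "(a + 2) mod n \<in> A (Suc a mod n)" using a n by (auto simp: A mod_Suc_eq)
  have "(a + 3) mod n = Suc ((a + 2) mod n) mod n" by (simp add: mod_Suc_eq numeral_3_eq_3)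
  then have A23: "(a + 3) mod n \<in> A ((a + 2) mod n)" using a n by (simp add: A)
  \<comment> \<open>For \<open>r = 1, 2, 3\<close> the vertex \<open>(a + r, b)\<close> of
    \<open>S\<close> is, in turn, the good vertex \<open>(a + 1, b)\<close> itself, a second
    dominator of it, and a second dominator of \<open>(a + 2, b)\<close>, which is good for
    \<open>(a + 2, b1)\<close>.\<close>
  from r_cases show False
  proof cases
    case 1
    then show ?thesis using S g by (simp add: good_def)
  next
    case 2
    then have "p ((a + 2) mod n) b = p a b"
      using good_private[OF g, of "p ((a + 2) mod n) b"] S sym_A[OF A12] by (simp add: N_iff)
    then have "(a + 2) mod n = a mod n" using a by simp
    then have "n dvd (a + 2) - a" using mod_eq_dvd_iff_nat[of a "a + 2" n] by simp
    then show False using n(1) by (auto dest: dvd_imp_le)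
  next
    case 3
    have "good (p ((a + 2) mod n) b1) (p ((a + 2) mod n) b)"
      using two[OF Z] by (simp add: zigzag_def)
    then have "p ((a + 3) mod n) b = p ((a + 2) mod n) b1"
      using good_private[of _ "p ((a + 2) mod n) b" "p ((a + 3) mod n) b"] S 3 sym_A[OF A23]
      by (simp add: N_iff)
    moreover have "b1 \<in> B b" using Z by (simp add: zigzag_def)
    ultimately show False using irrefl_B by auto
  qed
qed

end

section \<open>Later steps\<close>

text \<open>Invariant: after each step, a set of at most \<open>|N[S] - S|\<close> vertices contains all observed
  vertices that still have an unobserved neighbour; a force moves one element of this set.\<close>

lemma card_chains:
  assumes V: "finite (pverts G)" "S \<subseteq> pverts G" "parcs G \<subseteq> pverts G \<times> pverts G"
  shows "card (power_prop G S (Suc (Suc i))) \<le> card (power_prop G S (Suc i)) + card (closed_nbhd G S - S)"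
proof -
  let ?P = "power_prop G S"
  have sub: "?P (Suc i) \<subseteq> pverts G" for i
    by (induction i) (use V in \<open>auto simp: closed_nbhd_def nbhd_def\<close>)
  have fin: "finite (?P (Suc i))" for i
    using sub V(1) finite_subset by blast
  define W where "W i = ?P (Suc (Suc i)) - ?P (Suc i)" for i
  have "\<exists>g. \<forall>w\<in>W i. g w \<in> ?P (Suc i) \<and> nbhd G (g w) - ?P (Suc i) = {w}" for i
    by (intro bchoice) (auto simp: W_def)
  then obtain g where g: "\<And>i w. w \<in> W i \<Longrightarrow> g i w \<in> ?P (Suc i)"
      "\<And>i w. w \<in> W i \<Longrightarrow> nbhd G (g i w) - ?P (Suc i) = {w}"
    by metis
  have step: "?P (Suc (Suc i)) = ?P (Suc i) \<union> W i" "?P (Suc i) \<inter> W i = {}" for i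
    by (auto simp: W_def)
  have inj: "inj_on (g i) (W i)" for i
    using g(2)[of _ i] by (intro inj_onI) (metis singleton_inject)
  have finW: "finite (W i)" for i
    using fin[of "Suc i"] by (auto simp: W_def)
  have ex: "\<exists>A. A \<subseteq> ?P (Suc i) \<and> card A \<le> card (closed_nbhd G S - S) \<and>
      (\<forall>x\<in>?P (Suc i) - A. nbhd G x \<subseteq> ?P (Suc i))" for i
  proof (induction i)
    case 0
    show ?case
      by (intro exI[of _ "closed_nbhd G S - S"]) (auto simp: closed_nbhd_def)
  next
    case (Suc i)
    then obtain A where A: "A \<subseteq> ?P (Suc i)" "card A \<le> card (closed_nbhd G S - S)"
        "\<forall>x\<in>?P (Suc i) - A. nbhd G x \<subseteq> ?P (Suc i)"
      by blast
    have gA: "g i ` W i \<subseteq> A"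
      using g[of _ i] A(3) by blast
    have "finite A" using A(1) fin finite_subset by blast
    let ?A = "A - g i ` W i \<union> W i"
    have "card ?A \<le> card (A - g i ` W i) + card (W i)"
      by (rule card_Un_le)
    also have "\<dots> = card A"
      using gA \<open>finite A\<close> card_image[OF inj] card_mono[OF \<open>finite A\<close> gA] finW
      by (simp add: card_Diff_subset)
    finally have "card ?A \<le> card (closed_nbhd G S - S)" using A(2) by simp
    moreover have "?A \<subseteq> ?P (Suc (Suc i))" unfolding step using A(1) by blast
    moreover have "\<forall>x\<in>?P (Suc (Suc i)) - ?A. nbhd G x \<subseteq> ?P (Suc (Suc i))"
    proof
      fix x assume "x \<in> ?P (Suc (Suc i)) - ?A"
      then consider "x \<in> ?P (Suc i) - A" | w where "w \<in> W i" "x = g i w"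
        unfolding step(1) by blast
      then show "nbhd G x \<subseteq> ?P (Suc (Suc i))"
      proof cases
        case 1
        then show ?thesis unfolding step(1) using A(3) by blast
      next
        case 2
        have "nbhd G x - ?P (Suc i) = {w}" unfolding 2(2) by (rule g(2)[OF 2(1)])
        then have "nbhd G x \<subseteq> ?P (Suc i) \<union> {w}" unfolding Diff_subset_conv[symmetric] by (rule equalityD1)
        then show ?thesis unfolding step(1) by (rule order_trans) (use 2(1) in \<open>intro Un_mono, auto\<close>)
      qed
    qed
    ultimately show ?case by (intro exI[of _ ?A] conjI)
  qed
  obtain A where A: "A \<subseteq> ?P (Suc i)" "card A \<le> card (closed_nbhd G S - S)"
      "\<forall>x\<in>?P (Suc i) - A. nbhd G x \<subseteq> ?P (Suc i)"
    using ex[of i] by (elim exE conjE)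
  have "g i ` W i \<subseteq> A"
    using g[of _ i] A(3) by blast
  then have "card (W i) \<le> card A"
    using card_image[OF inj] card_mono[of A "g i ` W i"] A(1) fin finite_subset by metis
  then show ?thesis
    using A(2) card_Un_le[of "?P (Suc i)" "W i"] unfolding step(1) by linarith
qed

text \<open>Iterates \<open>card_chains\<close>, starting from \<open>i \<ge> 1\<close> because the
  passage from step 0 to step 1 is domination and not forcing.\<close>

lemma card_power_prop_le:
  assumes "finite (pverts G)" "S \<subseteq> pverts G" "parcs G \<subseteq> pverts G \<times> pverts G"
    and "i \<ge> 1"
  shows "card (power_prop G S (i + j)) \<le> card (power_prop G S i) + j * card (closed_nbhd G S - S)"
proof (induction j)
  case (Suc j)
  obtain k where "i + j = Suc k" using assms(4) by (cases "i + j") auto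
  then show ?case
    using Suc card_chains[OF assms(1-3), where i = k] by simp
qed simp

lemma card_new_le:
  assumes "finite S" "\<And>v. v \<in> S \<Longrightarrow> card (nbhd G v) \<le> d" "\<And>v. v \<in> S \<Longrightarrow> finite (nbhd G v)"
  shows "card (closed_nbhd G S - S) \<le> d * card S"
proof -
  have "card (closed_nbhd G S - S) \<le> card (\<Union> (nbhd G ` S))"
    using assms by (intro card_mono) (auto simp: closed_nbhd_def)
  also have "\<dots> \<le> (\<Sum>v\<in>S. card (nbhd G v))"
    by (rule card_UN_le) (rule assms)
  also have "\<dots> \<le> d * card S"
    using sum_bounded_above[of S "\<lambda>v. card (nbhd G v)" d] assms(2) by (simp add: mult.commute)
  finally show ?thesis .
qed

section \<open>Products of paths and cycles\<close>

lemma path_or_cycle_cases: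
  assumes "J \<in> path_or_cycle n"
  obtains "J = path_graph n" | "J = cycle_graph n" "n \<ge> 3"
  using assms by (auto simp: path_or_cycle_def split: if_splits)

lemma pverts_path_or_cycle: "J \<in> path_or_cycle n \<Longrightarrow> pverts J = {..<n}"
  by (erule path_or_cycle_cases) (auto simp: path_graph_def cycle_graph_def)

lemma parcs_path_subset: "J \<in> path_or_cycle n \<Longrightarrow> parcs (path_graph n) \<subseteq> parcs J"
  by (erule path_or_cycle_cases) (auto simp: path_graph_def cycle_graph_def)

lemma card_nbhd_path_or_cycle:
  assumes "J \<in> path_or_cycle n"
  shows "finite (nbhd J x) \<and> card (nbhd J x) \<le> 2"
proof -
  have "nbhd J x \<subseteq> {Suc x mod n, if x = 0 then n - 1 else x - 1}"
    using assms
  proof (cases rule: path_or_cycle_cases)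
    case 1
    then show ?thesis by (auto simp: path_graph_def nbhd_def)
  next
    case 2
    then show ?thesis by (auto simp: cycle_graph_def nbhd_def mod_Suc split: if_splits)
  qed
  moreover have "card {Suc x mod n, if x = 0 then n - 1 else x - 1} \<le> 2"
    by (simp add: card_insert_if)
  ultimately show ?thesis
    by (meson card_mono finite.emptyI finite.insertI finite_subset le_trans)
qed

lemma nbhd_sym:
  assumes "pair_graph J" "x' \<in> nbhd J x"
  shows "x \<in> nbhd J x'"
proof -
  interpret pair_graph J by fact
  show ?thesis
    using assms(2) pair_sym_arcs by (auto simp: nbhd_def symmetric_def dest: symD)
qed

lemma nbhd_irrefl:
  assumes "pair_graph J"
  shows "x \<notin> nbhd J x"
proof -
  interpret pair_graph J by fact
  show ?thesis
    using pair_no_loops[of "(x, x)"] by (auto simp: nbhd_def)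
qed

lemma nbhd_subset:
  assumes "pair_graph J"
  shows "nbhd J x \<subseteq> pverts J"
proof -
  interpret pair_graph J by fact
  show ?thesis
    using in_arcsD2 by (auto simp: nbhd_def)
qed

text \<open>The share argument, with one forcing vertex chosen for each vertex new in step 2, gives
  at most \<open>card S + 7 * card S\<close>. Equality makes every share 7 and so starts a zigzag,
  which only a cycle of length divisible by 4 can carry.\<close>

lemma second_step:
  assumes J: "J \<in> path_or_cycle n" and K: "K \<in> path_or_cycle m"
    and S: "S \<noteq> {}" "S \<subseteq> pverts (cartesian_product J K)"
  defines "G \<equiv> cartesian_product J K"
  shows "card (closed_nbhd G S - S) \<le> 4 * card S"
    and "card (power_prop G S 2) \<le> 8 * card S"
    and "card (power_prop G S 2) < 8 * card S \<or> (J = cycle_graph n \<and> n \<ge> 3 \<and> 4 dvd n)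
      \<or> (K = cycle_graph m \<and> m \<ge> 3 \<and> 4 dvd m)"
proof -
  have pg: "pair_graph J" "pair_graph K" using J K pair_graph_path_or_cycle by auto
  \<comment> \<open>\<open>nbhd G\<close> is empty outside the vertex set, while \<open>N\<close>
    follows the product formula everywhere, as the locale demands; they agree on the vertices of
    \<open>G\<close>.\<close>
  define N where "N = (\<lambda>(x, y). (\<lambda>x'. (x', y)) ` nbhd J x \<union> Pair x ` nbhd K y)"
  have N: "nbhd G v = N v" if "v \<in> pverts G" for v
    using that nbhd_subset[OF pg(1)] nbhd_subset[OF pg(2)]
    by (cases v) (auto simp: N_def nbhd_def G_def cartesian_product_def)
  let ?O = "S \<union> \<Union> (N ` S)"
  have O: "closed_nbhd G S = ?O"
  proof -
    have "nbhd G v = N v" if "v \<in> S" for v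
      using that S(2) unfolding G_def[symmetric] by (intro N) blast
    then show ?thesis unfolding closed_nbhd_def by simp
  qed
  have sub: "?O \<subseteq> pverts G"
    unfolding O[symmetric] using S(2) by (auto simp: closed_nbhd_def nbhd_def G_def cartesian_product_def)
  have fin: "finite (pverts G)"
    by (simp add: G_def cartesian_product_def pverts_path_or_cycle[OF J] pverts_path_or_cycle[OF K])
  have finS: "finite S" using S(2) fin G_def finite_subset by blast
  define W where "W = power_prop G S 2 - ?O"
  have P2: "power_prop G S 2 = ?O \<union> W" "?O \<inter> W = {}"
    by (auto simp: W_def numeral_2_eq_2 O)
  have "\<exists>g. \<forall>w\<in>W. g w \<in> ?O \<and> N (g w) - ?O = {w}"
  proof (intro bchoice ballI)
    fix w assume "w \<in> W"
    then obtain u where "u \<in> ?O" "nbhd G u - ?O = {w}"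
      by (auto simp: W_def numeral_2_eq_2 O)
    then show "\<exists>u. u \<in> ?O \<and> N u - ?O = {w}" using N sub by blast
  qed
  then obtain g where g: "\<And>w. w \<in> W \<Longrightarrow> g w \<in> ?O" "\<And>w. w \<in> W \<Longrightarrow> N (g w) - ?O = {w}"
    by blast
  have inj: "inj_on g W"
    using g(2) by (intro inj_onI) (metis singleton_inject)
  define R where "R = g ` W"
  define f where "f = inv_into W g"
  interpret propagation_step Pair "nbhd J" "nbhd K" N S R f
  proof unfold_locales
    show "inj_on f R" unfolding f_def R_def by (rule inj_on_inv_into) simp
    show "N u - ?O = {f u}" if "u \<in> R" for u
    proof -
      obtain w where w: "w \<in> W" "u = g w" using \<open>u \<in> R\<close> by (auto simp: R_def)
      then have "f u = w" using inj by (simp add: f_def)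
      with g(2)[OF w(1)] w(2) show ?thesis by simp
    qed
    show "\<exists>x y. v = (x, y)" for v :: "nat \<times> nat" by (cases v) auto
  qed (use nbhd_irrefl[OF pg(1)] nbhd_irrefl[OF pg(2)] card_nbhd_path_or_cycle[OF J]
      card_nbhd_path_or_cycle[OF K] in
      \<open>auto simp: N_def intro: nbhd_sym[OF pg(1)] nbhd_sym[OF pg(2)]\<close>)
  have obs: "observed = ?O" by (simp add: observed_def)
  have "card (nbhd G v) \<le> 4" "finite (nbhd G v)" if "v \<in> S" for v
    using N[of v] that S(2) card_N_le[of v] N_finite[of v] G_def by auto
  then show "card (closed_nbhd G S - S) \<le> 4 * card S"
    using finS by (intro card_new_le) auto
  have R: "R \<subseteq> observed - S"
  proof
    fix u assume "u \<in> R"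
    then obtain w where w: "w \<in> W" "u = g w" by (auto simp: R_def)
    have "u \<notin> S"
    proof
      assume "u \<in> S"
      then have "N u - ?O = {}" by blast
      then show False using g(2)[OF w(1)] w(2) by simp
    qed
    then show "u \<in> observed - S" using g(1)[OF w(1)] w(2) unfolding obs by blast
  qed
  have finO: "finite ?O" using sub fin by (rule finite_subset)
  have "card (power_prop G S 2) \<le> card ?O + card W"
    unfolding P2(1) by (rule card_Un_le)
  also have "card ?O = card S + card (?O - S)"
    using card_Diff_subset[OF finS, of ?O] card_mono[OF finO, of S] by simp
  also have "card W = card R"
    unfolding R_def using inj by (simp add: card_image)
  finally have le: "card (power_prop G S 2) \<le> card S + (\<Sum>v\<in>S. card (N v) + card {u. good v u})"
    using card_observed_forcing_le[OF finS R] obs by simp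
  have le7: "(\<Sum>v\<in>S. card (N v) + card {u. good v u}) \<le> (\<Sum>v\<in>S. 7)"
    by (rule sum_mono) (rule card_good_le)
  with le show "card (power_prop G S 2) \<le> 8 * card S" by simp
  show "card (power_prop G S 2) < 8 * card S \<or> (J = cycle_graph n \<and> n \<ge> 3 \<and> 4 dvd n)
      \<or> (K = cycle_graph m \<and> m \<ge> 3 \<and> 4 dvd m)"
  proof (cases "\<forall>v\<in>S. card (N v) + card {u. good v u} = 7")
    case False
    then obtain v where "v \<in> S" "card (N v) + card {u. good v u} < 7"
      using card_good_le by force
    then have "(\<Sum>v\<in>S. card (N v) + card {u. good v u}) < (\<Sum>v\<in>S. 7)"
      using finS card_good_le by (intro sum_strict_mono_ex1) auto
    with le show ?thesis by simp
  next
    case True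
    interpret swap: propagation_step "\<lambda>x y. (y, x)" "nbhd K" "nbhd J" N S R f by (rule swapped)
    note nice = True[rule_format]
    obtain v where "v \<in> S" using S(1) by blast
    then consider a b b1 where "zigzag a b b1" | a b a1 where "swap.zigzag b a a1"
      using ex_zigzag nice by blast
    then show ?thesis
    proof cases
      case 1
      from J show ?thesis
      proof (cases rule: path_or_cycle_cases)
        assume "J = path_graph n"
        then have "nbhd J x = {x'. x < n \<and> x' < n \<and> (x' = Suc x \<or> x = Suc x')}" for x
          by (auto simp: nbhd_def path_graph_def)
        then show ?thesis using no_zigzag_path[OF nice] 1 by blast
      next
        assume *: "J = cycle_graph n" "n \<ge> 3"
        then have "nbhd J x = {x'. x < n \<and> x' < n \<and> (x' = Suc x mod n \<or> x = Suc x' mod n)}" for x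
          by (auto simp: nbhd_def cycle_graph_def)
        then show ?thesis
          using no_zigzag_cycle[OF nice _ *(2)] 1 * unfolding dvd_eq_mod_eq_0 by blast
      qed
    next
      case 2
      from K show ?thesis
      proof (cases rule: path_or_cycle_cases)
        assume "K = path_graph m"
        then have "nbhd K x = {x'. x < m \<and> x' < m \<and> (x' = Suc x \<or> x = Suc x')}" for x
          by (auto simp: nbhd_def path_graph_def)
        then show ?thesis using swap.no_zigzag_path[OF nice] 2 by blast
      next
        assume *: "K = cycle_graph m" "m \<ge> 3"
        then have "nbhd K x = {x'. x < m \<and> x' < m \<and> (x' = Suc x mod m \<or> x = Suc x' mod m)}" for x
          by (auto simp: nbhd_def cycle_graph_def)
        then show ?thesis
          using swap.no_zigzag_cycle[OF nice _ *(2)] 2 * unfolding dvd_eq_mod_eq_0 by blast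
      qed
    qed
  qed
qed

section \<open>Comparison of the domination number with \<open>|S| t\<close>\<close>

lemma dominable_product:
  assumes "J \<in> path_or_cycle n" "K \<in> path_or_cycle m" "dominable (grid n m) k"
  shows "dominable (cartesian_product J K) k"
  using assms(3)
proof (rule dominable_mono)
  show "parcs (grid n m) \<subseteq> parcs (cartesian_product J K)"
    using parcs_path_subset[OF assms(1)] parcs_path_subset[OF assms(2)]
    by (auto simp: cartesian_product_def path_graph_def pverts_path_or_cycle[OF assms(1)]
        pverts_path_or_cycle[OF assms(2)])
qed (simp add: cartesian_product_def path_graph_def pverts_path_or_cycle[OF assms(1)]
    pverts_path_or_cycle[OF assms(2)])

text \<open>Counting observed vertices bounds \<open>n * m\<close> by a multiple of
  \<open>card S * t\<close>, and explicit dominating sets bound the domination number by a matching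
  fraction of \<open>n * m\<close>.\<close>

lemma domination_le_product:
  assumes n: "n \<ge> 1" "m \<ge> 1" and J: "J \<in> path_or_cycle n" and K: "K \<in> path_or_cycle m"
    and S: "S \<noteq> {}" "S \<subseteq> pverts (cartesian_product J K)"
    and t: "t \<ge> 1" "power_prop (cartesian_product J K) S t = pverts (cartesian_product J K)"
  shows "domination_number (cartesian_product J K) \<le> card S * t"
proof -
  define G where "G = cartesian_product J K"
  have V: "pverts G = {..<n} \<times> {..<m}"
    by (simp add: G_def cartesian_product_def pverts_path_or_cycle[OF J] pverts_path_or_cycle[OF K])
  have wf: "finite (pverts G)" "parcs G \<subseteq> pverts G \<times> pverts G"
    by (auto simp: V) (auto simp: G_def cartesian_product_def pverts_path_or_cycle[OF J]
        pverts_path_or_cycle[OF K])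
  have SG: "S \<subseteq> pverts G" "finite S" using S(2) wf(1) finite_subset by (auto simp: G_def)
  have tG: "power_prop G S t = pverts G" using t(2) by (simp add: G_def)
  note dom = domination_number_le[OF wf]
  have small: "dominable G k" if "dominable (grid n m) k" for k
    unfolding G_def by (rule dominable_product[OF J K that])
  have "dominable G (card S * t)"
  proof (cases "t = 1")
    case True
    then have "closed_nbhd G S = pverts G" using tG by simp
    then have "\<forall>v\<in>pverts G. v \<in> S \<or> (\<exists>u\<in>S. (u, v) \<in> parcs G)"
      by (fastforce simp: closed_nbhd_def nbhd_def)
    then show ?thesis unfolding dominable_def using SG True by auto
  next
    case False
    then have t2: "t \<ge> 2" using t(1) by simp
    note ss = second_step[OF J K S, folded G_def]
    let ?q = "card (closed_nbhd G S - S)"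
    have cV: "card (power_prop G S t) = n * m" using tG V by simp
    show ?thesis
    \<comment> \<open>With a one-vertex factor all degrees are at most 2, so the count gives
      \<open>card S * (1 + 2 * t)\<close>, to be compared with the ceiling of
      \<open>n * m / 3\<close>.\<close>
    proof (cases "n = 1 \<or> m = 1")
      case True
      have nb: "card (nbhd G v) \<le> 2" "finite (nbhd G v)" for v
      proof -
        obtain x y where v: "v = (x, y)" by fastforce
        have single: "nbhd J x = {}" if "n = 1" for x
          using J that by (auto simp: path_or_cycle_def path_graph_def nbhd_def)
        have single': "nbhd K x = {}" if "m = 1" for x
          using K that by (auto simp: path_or_cycle_def path_graph_def nbhd_def)
        have "nbhd G v \<subseteq> Pair x ` nbhd K y \<or> nbhd G v \<subseteq> (\<lambda>x'. (x', y)) ` nbhd J x"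
          using True single[of x] single'[of y]
          by (auto simp: v G_def cartesian_product_def nbhd_def)
        moreover have "card (Pair x ` nbhd K y) \<le> 2" "card ((\<lambda>x'. (x', y)) ` nbhd J x) \<le> 2"
          "finite (Pair x ` nbhd K y)" "finite ((\<lambda>x'. (x', y)) ` nbhd J x)"
          using card_nbhd_path_or_cycle[OF J, of x] card_nbhd_path_or_cycle[OF K, of y]
          by (auto simp: card_image inj_on_def)
        ultimately show "card (nbhd G v) \<le> 2" "finite (nbhd G v)"
          by (meson card_mono le_trans, meson finite_subset)
      qed
      have q: "?q \<le> 2 * card S"
        using SG(2) nb by (rule card_new_le)
      have "card (power_prop G S 1) \<le> card S + ?q"
      proof -
        have "closed_nbhd G S = S \<union> (closed_nbhd G S - S)" by (auto simp: closed_nbhd_def)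
        then show ?thesis by (metis One_nat_def card_Un_le power_prop.simps(2))
      qed
      moreover have "card (power_prop G S (1 + (t - 1))) \<le> card (power_prop G S 1) + (t - 1) * ?q"
        by (rule card_power_prop_le[OF wf(1) SG(1) wf(2)]) simp
      ultimately have "n * m \<le> card S + ?q + (t - 1) * ?q" using cV t2 by simp
      also have "\<dots> = card S + t * ?q" using t2 by (cases t) auto
      also have "\<dots> \<le> card S + t * (2 * card S)" using q by simp
      also have "\<dots> \<le> 3 * (card S * t)" using t2 by (cases t) auto
      finally have "(n * m + 2) div 3 \<le> card S * t" by linarith
      moreover have "dominable (grid n m) ((n * m + 2) div 3)"
        using True dominable_one[of m] dominable_swap[OF dominable_one[of n]] by auto
      ultimately show ?thesis using small dominable_le by blast
    next
      case False
      then have nm: "n \<ge> 2" "m \<ge> 2" using n by auto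
      have "card (power_prop G S (2 + (t - 2))) \<le> card (power_prop G S 2) + (t - 2) * ?q"
        by (rule card_power_prop_le[OF wf(1) SG(1) wf(2)]) simp
      moreover have "(t - 2) * ?q \<le> (t - 2) * (4 * card S)"
        using ss(1) by simp
      ultimately have *: "n * m \<le> card (power_prop G S 2) + (t - 2) * (4 * card S)"
        using cV t2 by (simp only: le_add_diff_inverse)
      have **: "8 * card S + (t - 2) * (4 * card S) = 4 * (card S * t)"
      proof -
        obtain j where "t = 2 + j" using t2 le_Suc_ex by blast
        then show ?thesis by (simp add: algebra_simps)
      qed
      have le: "n * m \<le> 4 * (card S * t)" using * ss(2) ** by linarith
      have "n * m < 4 * (card S * t)" if "card (power_prop G S 2) < 8 * card S"
        using that * ** by linarith
      then consider "n * m < 4 * (card S * t)"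
        | "J = cycle_graph n" "4 dvd n" | "K = cycle_graph m" "4 dvd m"
        using ss(3) by blast
      then show ?thesis
      proof cases
        case 1
        \<comment> \<open>Strictness pays for the \<open>+ 1\<close> in the bound for grids.\<close>
        then have "n * m div 4 + 1 \<le> card S * t" by linarith
        then show ?thesis
          using small[OF dominable_grid[OF nm]] dominable_le by blast
      next
        case 2
        then obtain k where k: "n = 4 * k" by blast
        have "dominable G (k * m)"
          unfolding G_def
          by (rule dominable_cycle) (use 2(1) k nm parcs_path_subset[OF K] pverts_path_or_cycle[OF J]
              pverts_path_or_cycle[OF K] in simp_all)
        \<comment> \<open>The cyclic pattern has exactly a quarter of the vertices, so the
          non-strict inequality suffices.\<close>
        moreover have "k * m \<le> card S * t" using le k by simp
        ultimately show ?thesis using dominable_le by blast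
      next
        case 3
        then obtain k where k: "m = 4 * k" by blast
        have "dominable (cartesian_product K J) (k * n)"
          by (rule dominable_cycle) (use 3(1) k nm parcs_path_subset[OF J] pverts_path_or_cycle[OF J]
              pverts_path_or_cycle[OF K] in simp_all)
        then have "dominable G (k * n)" unfolding G_def by (rule dominable_swap)
        moreover have "k * n \<le> card S * t" using le k by (simp add: mult.commute)
        ultimately show ?thesis using dominable_le by blast
      qed
    qed
  qed
  then show ?thesis using dom G_def by simp
qed

theorem corollary6p13:
  fixes n m :: nat and J K :: "nat pair_pre_digraph"
  assumes "n \<ge> 1" and "m \<ge> 1"
    and "J \<in> path_or_cycle n" and "K \<in> path_or_cycle m"
  shows "product_power_throttling (cartesian_product J K)
           = enat (domination_number (cartesian_product J K))"
proof -
  define G where "G = cartesian_product J K"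
  have V: "pverts G = {..<n} \<times> {..<m}"
    using assms by (simp add: G_def cartesian_product_def pverts_path_or_cycle)
  then have fin: "finite (pverts G)" and ne: "pverts G \<noteq> {}"
    using assms(1,2) by (auto simp: lessThan_empty_iff)
  let ?F = "\<lambda>S. enat (card S) * power_prop_time G S"
  have lower: "enat (domination_number G) \<le> ?F S" if S: "S \<noteq> {}" "S \<subseteq> pverts G" for S
  proof (cases "power_dominating_set G S")
    case True
    let ?Q = "\<lambda>t. t \<ge> 1 \<and> power_prop G S t = pverts G"
    obtain t where t: "power_prop G S t = pverts G"
      using True by (auto simp: power_dominating_set_def)
    have "\<exists>t. ?Q t"
    proof (cases t)
      \<comment> \<open>Here \<open>S = pverts G\<close>; as the propagation time is at least 1, the
        witness becomes 1.\<close>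
      case 0
      then have "?Q 1" using t by (auto simp: closed_nbhd_def nbhd_def G_def cartesian_product_def)
      then show ?thesis by blast
    qed (use t in auto)
    then have "?Q (LEAST t. ?Q t)" by (rule LeastI_ex)
    then have "domination_number G \<le> card S * (LEAST t. ?Q t)"
      using domination_le_product[OF assms S[unfolded G_def]] by (simp add: G_def)
    then show ?thesis using True by (simp add: power_prop_time_def)
  next
    case False
    have "finite S" using S(2) fin by (rule finite_subset)
    \<comment> \<open>In \<open>enat\<close>, \<open>0 * \<infinity> = 0\<close>, so an infinite
      product needs \<open>S\<close> to be nonempty.\<close>
    then have "card S \<noteq> 0" using S(1) by simp
    then show ?thesis using False by (simp add: power_prop_time_def enat_0_iff)
  qed
  have "{S. dominating_set G S} \<subseteq> Pow (pverts G)" by (auto simp: dominating_set_def)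
  then have finD: "finite {S. dominating_set G S}" using fin finite_subset by blast
  have "dominating_set G (pverts G)"
    by (auto simp: dominating_set_def closed_nbhd_def nbhd_def G_def cartesian_product_def)
  then have "domination_number G \<in> card ` {S. dominating_set G S}"
    unfolding domination_number_def using finD by (intro Min_in) auto
  then obtain D where D: "dominating_set G D" "card D = domination_number G" by auto
  then have D': "D \<noteq> {}" "D \<subseteq> pverts G"
    using ne by (auto simp: dominating_set_def closed_nbhd_def)
  \<comment> \<open>A minimum dominating set finishes in one step, so the lower bound is
    attained.\<close>
  have "power_prop G D (Suc 0) = pverts G" using D by (simp add: dominating_set_def)
  moreover from this have "power_dominating_set G D"
    unfolding power_dominating_set_def using D' by blast
  ultimately have "power_prop_time G D = enat 1"
    unfolding power_prop_time_def by (simp del: power_prop.simps, intro Least_equality) auto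
  then have "?F D = enat (domination_number G)" using D by simp
  then have "Min (?F ` {S. S \<noteq> {} \<and> S \<subseteq> pverts G}) = enat (domination_number G)"
    using D' lower fin by (intro Min_eqI) (auto intro!: image_eqI[of _ _ D])
  then show ?thesis by (simp add: product_power_throttling_def G_def)
qed

end
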